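(* Fix $t\in[0,T)$ and let $$V_t^{(1)}=\int_t^T \mathbb{E}\Big[f\big(X_u,v^{(0)}(X_u),z^{(0)}(X_u)\big)\,\Big|\,\mathcal{F}_t\Big]\,du .$$ Let $\lambda$ be an arbitrary deterministic positive intensity process and let $\tau$ be the associated interaction time started at $t$, drawn independently of $W$. For $s\ge t$ put $$\hat f_{t,s}(x):=\frac{1}{\lambda_s}\,e^{\int_t^s\lambda_u\,du}\,f\big(x,v^{(0)}(x),z^{(0)}(x)\big).$$ Then $$V_t^{(1)}=\mathbf{1}_{\{\tau>t\}}\,\mathbb{E}\Big[\mathbf{1}_{\{\tau<T\}}\,\hat f_{t,\tau}(X_\tau)\,\Big|\,\mathcal{F}_t\Big].$$
   Context: Let $(\Omega,\mathcal{F},P)$ be a probability space, $T\in(0,\infty)$, $W=(W^1,\dots,W^r)$ an $r$-dimensional Brownian motion, and $(\mathcal{F}_t)_{0\le t\le T}$ its $P$-augmented natural filtration. The forward process $X$ in $\mathbb{R}^d$ solves $dX_s=\gamma_0(X_s)ds+\gamma(X_s)\cdot dW_s$, with $\gamma_0:\mathbb{R}^d\to\mathbb{R}^d$, $\gamma:\mathbb{R}^d\to\mathbb{R}^{d\times r}$ (time may be one of the components of $X$); "$\cdot$" is summation over the $r$ Brownian components. The driver is $f:\mathbb{R}^d\times\mathbb{R}\times\mathbb{R}^r\to\mathbb{R}$. The functions $v^{(0)}:\mathbb{R}^d\to\mathbb{R}$ and $z^{(0)}:\mathbb{R}^d\to\mathbb{R}^r$ are given deterministic functions representing the solution $V^{(0)}_s=v^{(0)}(X_s)$,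 $Z^{(0)}_s=z^{(0)}(X_s)$ of the zeroth-order equation $dV^{(0)}_s=Z^{(0)}_s\cdot dW_s$, $V^{(0)}_T=\Psi(X_T)$, where $\Psi$ is a deterministic function. $V^{(1)}$ is the backward component of $dV^{(1)}_s=-f(X_s,V^{(0)}_s,Z^{(0)}_s)ds+Z^{(1)}_s\cdot dW_s$, $V^{(1)}_T=0$. Interaction time: $\lambda:[0,T]\to(0,\infty)$ is deterministic and integrable (for example a positive constant). The probability space is enlarged to carry a random time $\tau$ independent of $W$ (hence of $X$ and of $(\mathcal F_s)$) with $P(\tau>s)=e^{-\int_t^s\lambda_u du}$ for $s\in[t,T]$; it is the first event time after $t$ of an independent Poisson process with intensity $\lambda$. Standing assumption: appropriate regularity, here meaning that $X$ is well defined, $f,v^{(0)},z^{(0)}$ are measurable, and $\int_t^T\mathbb{E}|f(X_u,v^{(0)}(X_u),z^{(0)}(X_u))|du<\infty$. *)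

theory Defs
  imports "HOL-Probability.Probability"
begin

section \<open>Brownian motion and its augmented filtration\<close>

text \<open>
  Processes have type \<open>real \<Rightarrow> 'a \<Rightarrow> _\<close>; only their values at times in \<open>{0..T}\<close> matter.
  Filtrations are families of measures of which only the space and the sets are used.
\<close>

definition nat_filtration ::
    "'a measure \<Rightarrow> (real \<Rightarrow> 'a \<Rightarrow> real^'r) \<Rightarrow> real \<Rightarrow> 'a measure" where
  "nat_filtration M W s =
     sigma (space M) (\<Union>u\<in>{0..s}. {W u -` A \<inter> space M |A. A \<in> sets borel})"

text \<open>
  Augmentation adds the null sets that belong to \<open>sets M\<close>. If \<open>M\<close> is complete these are all
  the negligible sets; completeness is not required.
\<close>

definition aug_filtration ::
    "'a measure \<Rightarrow> (real \<Rightarrow> 'a \<Rightarrow> real^'r) \<Rightarrow> real \<Rightarrow> 'a measure" where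
  "aug_filtration M W s = sigma (space M) (sets (nat_filtration M W s) \<union> null_sets M)"

definition brownian_motion ::
    "'a measure \<Rightarrow> real \<Rightarrow> (real \<Rightarrow> 'a \<Rightarrow> real^'r) \<Rightarrow> bool" where
  "brownian_motion M T W \<longleftrightarrow>
     prob_space M \<and>
     (\<forall>s\<in>{0..T}. W s \<in> borel_measurable M) \<and>
     (AE \<omega> in M. W 0 \<omega> = 0) \<and>
     (\<forall>\<omega>\<in>space M. continuous_on {0..T} (\<lambda>s. W s \<omega>)) \<and>
     (\<forall>s u. 0 \<le> s \<and> s < u \<and> u \<le> T \<longrightarrow>
        prob_space.indep_set M
          (sets (nat_filtration M W s))
          (sets (vimage_algebra (space M) (\<lambda>\<omega>. W u \<omega> - W s \<omega>) borel)) \<and>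
        prob_space.indep_vars M (\<lambda>_. borel) (\<lambda>i \<omega>. (W u \<omega> - W s \<omega>) $ i) UNIV \<and>
        (\<forall>i. distributed M lborel (\<lambda>\<omega>. (W u \<omega> - W s \<omega>) $ i)
               (\<lambda>x. ennreal (normal_density 0 (sqrt (u - s)) x))))"

definition adapted ::
    "(real \<Rightarrow> 'a measure) \<Rightarrow> real \<Rightarrow> (real \<Rightarrow> 'a \<Rightarrow> 'b::topological_space) \<Rightarrow> bool" where
  "adapted F T H \<longleftrightarrow> (\<forall>s\<in>{0..T}. H s \<in> borel_measurable (F s))"

definition progressive ::
    "(real \<Rightarrow> 'a measure) \<Rightarrow> real \<Rightarrow> (real \<Rightarrow> 'a \<Rightarrow> 'b::topological_space) \<Rightarrow> bool" where
  "progressive F T H \<longleftrightarrow>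
     (\<forall>s\<in>{0..T}. (\<lambda>(u, \<omega>). H u \<omega>) \<in> borel_measurable (restrict_space borel {0..s} \<Otimes>\<^sub>M F s))"


section \<open>The Ito integral\<close>

text \<open>
  A simple integrand is \<open>\<Sum>k<n. \<xi> k * indicator {p k<..p (Suc k)}\<close>, where \<open>p\<close> is a partition of
  \<open>{0..T}\<close> and each \<open>\<xi> k\<close> is bounded and \<open>F (p k)\<close>-measurable.
\<close>

definition simple_integrand ::
    "'a measure \<Rightarrow> (real \<Rightarrow> 'a measure) \<Rightarrow> real \<Rightarrow> nat \<Rightarrow> (nat \<Rightarrow> real) \<Rightarrow> (nat \<Rightarrow> 'a \<Rightarrow> real^'r) \<Rightarrow> bool"
  where
  "simple_integrand M F T n p \<xi> \<longleftrightarrow>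
     p 0 = 0 \<and> p n = T \<and> (\<forall>k<n. p k \<le> p (Suc k)) \<and>
     (\<forall>k<n. \<xi> k \<in> borel_measurable (F (p k))) \<and>
     (\<exists>B. \<forall>k<n. \<forall>\<omega>\<in>space M. norm (\<xi> k \<omega>) \<le> B)"

definition simple_process ::
    "nat \<Rightarrow> (nat \<Rightarrow> real) \<Rightarrow> (nat \<Rightarrow> 'a \<Rightarrow> real^'r) \<Rightarrow> real \<Rightarrow> 'a \<Rightarrow> real^'r" where
  "simple_process n p \<xi> s \<omega> = (\<Sum>k<n. indicator {p k<..p (Suc k)} s *\<^sub>R \<xi> k \<omega>)"

definition simple_ito ::
    "(real \<Rightarrow> 'a \<Rightarrow> real^'r) \<Rightarrow> nat \<Rightarrow> (nat \<Rightarrow> real) \<Rightarrow> (nat \<Rightarrow> 'a \<Rightarrow> real^'r) \<Rightarrow> real \<Rightarrow> 'a \<Rightarrow> real" where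
  "simple_ito W n p \<xi> s \<omega> =
     (\<Sum>k<n. \<xi> k \<omega> \<bullet> (W (min (p (Suc k)) s) \<omega> - W (min (p k) s) \<omega>))"

text \<open>
  \<open>I\<close> is (a version of) the process \<open>s \<mapsto> \<integral>\<^sub>0\<^sup>s H\<^sub>u \<cdot> dW\<^sub>u\<close> on \<open>{0..T}\<close>: the limit, uniformly on
  \<open>{0..T}\<close> in probability, of the integrals of simple integrands that converge to \<open>H\<close> in
  \<open>L\<^sup>2({0..T})\<close> in probability.
\<close>

definition ito_integral ::
    "'a measure \<Rightarrow> (real \<Rightarrow> 'a measure) \<Rightarrow> real \<Rightarrow> (real \<Rightarrow> 'a \<Rightarrow> real^'r) \<Rightarrow>
       (real \<Rightarrow> 'a \<Rightarrow> real^'r) \<Rightarrow> (real \<Rightarrow> 'a \<Rightarrow> real) \<Rightarrow> bool" where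
  "ito_integral M F T W H I \<longleftrightarrow>
     progressive F T H \<and>
     (AE \<omega> in M. (\<integral>\<^sup>+u\<in>{0..T}. ennreal ((norm (H u \<omega>))\<^sup>2) \<partial>lborel) < \<infinity>) \<and>
     adapted F T I \<and>
     (\<forall>\<omega>\<in>space M. continuous_on {0..T} (\<lambda>s. I s \<omega>)) \<and>
     (\<exists>n p \<xi>.
        (\<forall>m. simple_integrand M F T (n m) (p m) (\<xi> m)) \<and>
        (\<forall>\<epsilon>>0. (\<lambda>m. measure M {\<omega>\<in>space M.
            (\<integral>\<^sup>+u\<in>{0..T}. ennreal ((norm (simple_process (n m) (p m) (\<xi> m) u \<omega> - H u \<omega>))\<^sup>2) \<partial>lborel)
              > ennreal \<epsilon>}) \<longlonglongrightarrow> 0) \<and>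
        (\<forall>\<epsilon>>0. (\<lambda>m. measure M {\<omega>\<in>space M.
            \<exists>s\<in>{0..T}. \<bar>simple_ito W (n m) (p m) (\<xi> m) s \<omega> - I s \<omega>\<bar> > \<epsilon>}) \<longlonglongrightarrow> 0))"

text \<open>\<open>dY\<^sub>s = a\<^sub>s ds + H\<^sub>s \<cdot> dW\<^sub>s\<close> on \<open>{0..T}\<close>, for real-valued \<open>Y\<close>.\<close>

definition ito_process ::
    "'a measure \<Rightarrow> (real \<Rightarrow> 'a measure) \<Rightarrow> real \<Rightarrow> (real \<Rightarrow> 'a \<Rightarrow> real^'r) \<Rightarrow>
       (real \<Rightarrow> 'a \<Rightarrow> real) \<Rightarrow> (real \<Rightarrow> 'a \<Rightarrow> real) \<Rightarrow> (real \<Rightarrow> 'a \<Rightarrow> real^'r) \<Rightarrow> bool" where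
  "ito_process M F T W Y a H \<longleftrightarrow>
     adapted F T Y \<and>
     progressive F T a \<and>
     (AE \<omega> in M. set_integrable lborel {0..T} (\<lambda>u. a u \<omega>)) \<and>
     (\<exists>I. ito_integral M F T W H I \<and>
        (AE \<omega> in M. \<forall>s\<in>{0..T}.
           Y s \<omega> = Y 0 \<omega> + (LINT u:{0..s}|lborel. a u \<omega>) + I s \<omega>))"


section \<open>The forward process and the zeroth-order backward equation\<close>

text \<open>The rows \<open>\<gamma> x $ i\<close> of the \<open>d \<times> r\<close> matrix \<open>\<gamma> x\<close> are the integrands of the components of \<open>X\<close>.\<close>

definition forward_process ::
    "'a measure \<Rightarrow> (real \<Rightarrow> 'a measure) \<Rightarrow> real \<Rightarrow> (real \<Rightarrow> 'a \<Rightarrow> real^'r) \<Rightarrow>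
       (real^'d \<Rightarrow> real^'d) \<Rightarrow> (real^'d \<Rightarrow> real^'r^'d) \<Rightarrow> (real \<Rightarrow> 'a \<Rightarrow> real^'d) \<Rightarrow> bool" where
  "forward_process M F T W \<gamma>\<^sub>0 \<gamma> X \<longleftrightarrow>
     (\<forall>\<omega>\<in>space M. continuous_on {0..T} (\<lambda>s. X s \<omega>)) \<and>
     (\<forall>i. ito_process M F T W (\<lambda>s \<omega>. X s \<omega> $ i)
            (\<lambda>s \<omega>. \<gamma>\<^sub>0 (X s \<omega>) $ i) (\<lambda>s \<omega>. \<gamma> (X s \<omega>) $ i))"

definition zeroth_order_solution ::
    "'a measure \<Rightarrow> (real \<Rightarrow> 'a measure) \<Rightarrow> real \<Rightarrow> (real \<Rightarrow> 'a \<Rightarrow> real^'r) \<Rightarrow>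
       (real \<Rightarrow> 'a \<Rightarrow> real^'d) \<Rightarrow> (real^'d \<Rightarrow> real) \<Rightarrow>
       (real^'d \<Rightarrow> real) \<Rightarrow> (real^'d \<Rightarrow> real^'r) \<Rightarrow> bool" where
  "zeroth_order_solution M F T W X \<Psi> v\<^sub>0 z\<^sub>0 \<longleftrightarrow>
     ito_process M F T W (\<lambda>s \<omega>. v\<^sub>0 (X s \<omega>)) (\<lambda>s \<omega>. 0) (\<lambda>s \<omega>. z\<^sub>0 (X s \<omega>)) \<and>
     (AE \<omega> in M. v\<^sub>0 (X T \<omega>) = \<Psi> (X T \<omega>))"


section \<open>The interaction time\<close>

text \<open>
  \<open>\<tau>\<close> takes values in \<open>[0, \<infinity>]\<close>; its law beyond \<open>T\<close> (where the intensity is not defined) is left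
  open, \<open>\<tau> = \<infinity>\<close> being possible.
\<close>

definition interaction_time ::
    "'a measure \<Rightarrow> real \<Rightarrow> (real \<Rightarrow> 'a \<Rightarrow> real^'r) \<Rightarrow> (real \<Rightarrow> real) \<Rightarrow> real \<Rightarrow> ('a \<Rightarrow> ennreal) \<Rightarrow> bool"
  where
  "interaction_time M T W lam t \<tau> \<longleftrightarrow>
     \<tau> \<in> borel_measurable M \<and>
     prob_space.indep_set M
       (sets (nat_filtration M W T)) (sets (vimage_algebra (space M) \<tau> borel)) \<and>
     (\<forall>s\<in>{t..T}. measure M {\<omega>\<in>space M. \<tau> \<omega> > ennreal s} = exp (- (LINT u:{t..s}|lborel. lam u)))"

definition f_hat ::
    "(real \<Rightarrow> real) \<Rightarrow> (real^'d \<Rightarrow> real \<Rightarrow> real^'r \<Rightarrow> real) \<Rightarrow> (real^'d \<Rightarrow> real) \<Rightarrow> (real^'d \<Rightarrow> real^'r) \<Rightarrow>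
       real \<Rightarrow> real \<Rightarrow> real^'d \<Rightarrow> real" where
  "f_hat lam f v\<^sub>0 z\<^sub>0 t s x =
     1 / lam s * exp (LINT u:{t..s}|lborel. lam u) * f x (v\<^sub>0 x) (z\<^sub>0 x)"


section \<open>Conditional expectations depending on a time parameter\<close>

text \<open>
  Conditional expectations are only determined up to null sets, so that integrating
  \<open>E[G\<^sub>u | F]\<close> in \<open>u\<close> requires versions that are jointly measurable in \<open>(u, \<omega>)\<close>. The
  versions are prescribed for almost every \<open>u\<close> only, as \<open>G\<^sub>u\<close> will be integrable
  for almost every \<open>u\<close> only.
\<close>

definition cond_exp_version ::
    "'a measure \<Rightarrow> 'a measure \<Rightarrow> real set \<Rightarrow> (real \<Rightarrow> 'a \<Rightarrow> real) \<Rightarrow> (real \<Rightarrow> 'a \<Rightarrow> real) \<Rightarrow> bool" where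
  "cond_exp_version M F S G Y \<longleftrightarrow>
     (\<lambda>(u, \<omega>). Y u \<omega>) \<in> borel_measurable (restrict_space borel S \<Otimes>\<^sub>M F) \<and>
     (AE u\<in>S in lborel. AE \<omega> in M. Y u \<omega> = real_cond_exp M F (G u) \<omega>)"

end

theory Submission
  imports Defs
begin

text \<open>
  Conditionally on the Brownian filtration, \<open>\<tau>\<close> restricted to \<open>{t<..T}\<close> has the density
  \<open>\<lambda>\<^sub>s exp (- \<integral>\<^sub>t\<^sup>s \<lambda>)\<close>, and the factor \<open>\<lambda>\<^sub>s\<inverse> exp (\<integral>\<^sub>t\<^sup>s \<lambda>)\<close> in \<open>f_hat\<close> cancels it. So for
  every event \<open>A\<close> of \<open>F t\<close> the integral over \<open>A\<close> of the randomised term is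
  \<open>\<integral>\<^sub>t\<^sup>T E[1\<^sub>A G\<^sub>u] du = \<integral>\<^sub>t\<^sup>T E[1\<^sub>A E[G\<^sub>u | F t]] du\<close>, which by Fubini's theorem is \<open>E[1\<^sub>A V\<^sub>t]\<close>;
  and \<open>\<tau> > t\<close> holds almost surely.
\<close>

section \<open>The law of the interaction time\<close>

text \<open>Several mismatches shape the argument. \<open>\<tau>\<close> is given as independent of
  the natural filtration, whereas \<open>X\<close> is adapted to the augmented one, so independence
  has to be carried across null sets. \<open>X\<close> is read at the random time
  \<open>\<tau>\<close>, so measurability at each fixed time does not suffice: joint measurability
  in time and outcome with respect to \<open>F T\<close> is required, and continuity of the paths
  supplies it. The conditional expectation of \<open>G u\<close> is a separate equivalence class for
  every \<open>u\<close>, and a jointly measurable choice is part of the claim, so it has to be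
  constructed. Beyond \<open>T\<close> the law of \<open>\<tau>\<close> is unknown and
  \<open>\<tau>\<close> may be infinite; computations are therefore restricted to
  \<open>\<tau> \<le> T\<close>, the complement of a survival event, and the passage to
  \<open>\<tau> < T\<close> rests on \<open>T\<close> not being an atom. The randomisation identity
  is obtained for integrals with values in [0, \<infinity>], where no integrability is at stake, and
  reaches signed integrands through positive and negative parts.\<close>

lemma set_integrable_measurable:
  fixes f :: "real \<Rightarrow> real"
  assumes "set_integrable lborel A f"
  shows "(\<lambda>s. indicator A s * f s) \<in> borel_measurable borel"
  using borel_measurable_integrable[OF assms[unfolded set_integrable_def]] by simp

section \<open>Change of variables along the integral of a merely integrable intensity\<close>

context
  fixes l :: "real \<Rightarrow> real" and a b :: real and L :: "real \<Rightarrow> real"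
  assumes ab: "a \<le> b"
    and int: "set_integrable lborel {a..b} l"
    and pos: "\<And>s. s \<in> {a..b} \<Longrightarrow> 0 < l s"
  defines "L \<equiv> \<lambda>s. LINT u:{a..s}|lborel. l u"
begin

lemmas [measurable] = set_integrable_measurable[OF int]

text \<open>Integrability over \<open>{a..b}\<close> yields measurability only of the product
  \<open>indicator {a..b} s * l s\<close>, so this product serves as the density in place of
  \<open>l\<close>.\<close>

lemma nn_integral_intensity:
  assumes "a \<le> c" "c \<le> d" "d \<le> b"
  shows "(\<integral>\<^sup>+s. ennreal (indicator {a..b} s * l s) * indicator {c<..d} s \<partial>lborel) = ennreal (L d - L c)"
    and "L c \<le> L d"
proof -
  have i: "set_integrable lborel {c<..d} l" "set_integrable lborel {a..c} l"
    by (rule set_integrable_subset[OF int]; use assms in auto)+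
  have "{a..c} \<union> {c<..d} = {a..d}" using assms by auto
  then have *: "L d = L c + (LINT u:{c<..d}|lborel. l u)"
    unfolding L_def using set_integral_Un[OF ivl_disj_int_two(8) i(2) i(1)] by simp
  have "(\<integral>\<^sup>+s. ennreal (indicator {a..b} s * l s) * indicator {c<..d} s \<partial>lborel)
      = (\<integral>\<^sup>+s. ennreal (indicator {c<..d} s * l s) \<partial>lborel)"
    by (intro nn_integral_cong) (use assms in \<open>auto split: split_indicator\<close>)
  also have "\<dots> = ennreal (LINT u:{c<..d}|lborel. l u)"
    unfolding set_lebesgue_integral_def
    using i(1) assms pos
    by (subst nn_integral_eq_integral)
       (auto simp: set_integrable_def intro!: AE_I2 less_imp_le split: split_indicator)
  finally show "(\<integral>\<^sup>+s. ennreal (indicator {a..b} s * l s) * indicator {c<..d} s \<partial>lborel) = ennreal (L d - L c)"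
    using * by simp
  have "0 \<le> (LINT u:{c<..d}|lborel. l u)"
    unfolding set_lebesgue_integral_def
    by (intro integral_nonneg_AE AE_I2) (use assms pos in \<open>auto intro!: less_imp_le split: split_indicator\<close>)
  with * show "L c \<le> L d" by simp
qed

text \<open>Without an increase of \<open>L\<close>, the nonnegative density would vanish almost
  everywhere on \<open>{c<..d}\<close>, an interval of positive length on which \<open>l\<close> is
  positive. Strictness allows comparisons of values of \<open>L\<close> to be read as comparisons of
  times.\<close>

lemma cumulative_intensity_strict_mono:
  assumes "a \<le> c" "c < d" "d \<le> b"
  shows "L c < L d"
proof (rule ccontr)
  assume "\<not> L c < L d"
  then have "(\<integral>\<^sup>+s. ennreal (indicator {a..b} s * l s) * indicator {c<..d} s \<partial>lborel) = 0"
    using nn_integral_intensity[of c d] assms by (simp add: ennreal_neg)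
  then have "AE s in lborel. ennreal (indicator {a..b} s * l s) * indicator {c<..d} s = 0"
    by (subst (asm) nn_integral_0_iff_AE) auto
  then have "AE s in lborel. s \<notin> {c<..d}"
  proof eventually_elim
    case (elim s)
    with pos[of s] assms show ?case by (auto simp: ennreal_eq_0_iff)
  qed
  then have "emeasure lborel {c<..d} = 0"
    by (subst (asm) AE_iff_measurable[where N="{c<..d}"]) auto
  then show False using assms by simp
qed

text \<open>Continuity of indefinite integrals is imported from the gauge integral, which agrees
  with the Lebesgue integral for the integrable function \<open>l\<close>.\<close>

lemma cumulative_intensity_continuous: "continuous_on {a..b} L"
proof -
  have "l integrable_on {a..b}" using set_borel_integral_eq_integral(1)[OF int] .
  then have "continuous_on {a..b} (\<lambda>s. integral {a..s} l)" by (rule indefinite_integral_continuous_1)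
  moreover have "integral {a..s} l = L s" if "s \<in> {a..b}" for s
    unfolding L_def
    by (rule set_borel_integral_eq_integral(2)[symmetric], rule set_integrable_subset[OF int]) (use that in auto)
  ultimately show ?thesis by (simp cong: continuous_on_cong_simp)
qed

text \<open>Clamping the argument extends \<open>L\<close> continuously, hence measurably, from
  \<open>{a..b}\<close> to the whole line without changing it on the interval.\<close>

lemma cumulative_intensity_measurable [measurable]: "(\<lambda>s. L (max a (min b s))) \<in> borel_measurable borel"
  by (intro borel_measurable_continuous_onI continuous_on_compose2[OF cumulative_intensity_continuous])
     (use ab in \<open>auto intro!: continuous_intros\<close>)

text \<open>
  The intensity is merely integrable, so the fundamental theorem of calculus does not apply to
  \<open>exp (- L s)\<close>. Instead, \<open>L\<close> maps the measure with density \<open>l\<close> to Lebesgue measure.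
\<close>

lemma distr_cumulative_intensity:
  assumes x: "x \<in> {a..b}"
  shows "distr (density lborel (\<lambda>s. ennreal (indicator {a..b} s * l s) * indicator {x<..b} s)) borel
           (\<lambda>s. L (max a (min b s))) = density lborel (indicator {L x<..L b})"
    (is "distr (density _ ?k) _ ?L = ?R")
proof (rule measure_eqI_lessThan)
  have eq: "emeasure (distr (density lborel ?k) borel ?L) {y<..} = emeasure ?R {y<..}
      \<and> emeasure ?R {y<..} < \<infinity>" for y
  proof -
    have LxLb: "L x \<le> L b" using nn_integral_intensity(2)[of x b] x by auto
    \<comment> \<open>The level \<open>y\<close> is clamped to the range of \<open>L\<close> on
      \<open>{x..b}\<close>, so that the intermediate value theorem applies to every
      \<open>y\<close>; levels below or above the range then give \<open>L c = L x\<close> or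
      \<open>L c = L b\<close>. Within \<open>{x<..b}\<close> the condition \<open>y < L s\<close>
      becomes \<open>c < s\<close>.\<close>
    obtain c where c: "c \<in> {x..b}" "L c = max (L x) (min (L b) y)"
      using IVT'[of L x "max (L x) (min (L b) y)" b] x LxLb
        continuous_on_subset[OF cumulative_intensity_continuous, of "{x..b}"] by auto
    have iff: "y < L s \<longleftrightarrow> c < s" if s: "s \<in> {x<..b}" for s
    proof -
      have "L x < L s" "L s \<le> L b"
        using cumulative_intensity_strict_mono[of x s] nn_integral_intensity(2)[of s b] s x by auto
      moreover have "c < s \<longleftrightarrow> L c < L s"
        using cumulative_intensity_strict_mono[of c s] nn_integral_intensity(2)[of s c] c s x
        by (cases "c < s") auto
      ultimately show ?thesis unfolding c(2) by auto
    qed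
    have "emeasure (distr (density lborel ?k) borel ?L) {y<..} = (\<integral>\<^sup>+s. ?k s * indicator (?L -` {y<..}) s \<partial>lborel)"
      by (subst emeasure_distr) (auto intro!: emeasure_density simp: measurable_sets[OF cumulative_intensity_measurable, simplified])
    also have "\<dots> = (\<integral>\<^sup>+s. ennreal (indicator {a..b} s * l s) * indicator {c<..b} s \<partial>lborel)"
      by (intro nn_integral_cong) (use iff c x in \<open>auto split: split_indicator\<close>)
    also have "\<dots> = ennreal (L b - L c)"
      using c x by (intro nn_integral_intensity) auto
    finally have 1: "emeasure (distr (density lborel ?k) borel ?L) {y<..} = ennreal (L b - L c)" .
    have "emeasure ?R {y<..} = emeasure lborel ({L x<..L b} \<inter> {y<..})"
      by (subst emeasure_density) (auto simp flip: indicator_inter_arith)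
    also have "{L x<..L b} \<inter> {y<..} = {L c<..L b}" unfolding c(2) using LxLb by auto
    also have "emeasure lborel \<dots> = ennreal (L b - L c)" unfolding c(2) using LxLb by simp
    finally show ?thesis using 1 by simp
  qed
  show "emeasure (distr (density lborel ?k) borel ?L) {y<..} < \<infinity>" for y using eq by simp
  show "emeasure (distr (density lborel ?k) borel ?L) {y<..} = emeasure ?R {y<..}" for y using eq by simp
qed auto

text \<open>After the substitution y = \<open>L s\<close> the integrand is the smooth function
  exp(-y), to which the fundamental theorem of calculus does apply.\<close>

lemma nn_integral_exp_cumulative_intensity:
  assumes x: "x \<in> {a..b}"
  shows "(\<integral>\<^sup>+s. ennreal (indicator {a..b} s * l s * exp (- L s)) * indicator {x<..b} s \<partial>lborel)
      = ennreal (exp (- L x) - exp (- L b))"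
proof -
  let ?k = "\<lambda>s. ennreal (indicator {a..b} s * l s) * indicator {x<..b} s"
  let ?L = "\<lambda>s. L (max a (min b s))"
  have LxLb: "L x \<le> L b" using nn_integral_intensity(2)[of x b] x by auto
  have "(\<integral>\<^sup>+s. ennreal (indicator {a..b} s * l s * exp (- L s)) * indicator {x<..b} s \<partial>lborel)
      = (\<integral>\<^sup>+s. ?k s * ennreal (exp (- ?L s)) \<partial>lborel)"
    by (intro nn_integral_cong)
       (use x pos in \<open>auto simp: ennreal_mult less_imp_le split: split_indicator\<close>)
  also have "\<dots> = (\<integral>\<^sup>+s. ennreal (exp (- ?L s)) \<partial>density lborel ?k)"
    by (subst nn_integral_density) auto
  also have "\<dots> = (\<integral>\<^sup>+y. ennreal (exp (- y)) \<partial>density lborel (indicator {L x<..L b}))"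
    unfolding distr_cumulative_intensity[OF x, symmetric] by (subst nn_integral_distr) auto
  \<comment> \<open>The left endpoint, a null set, is added because the fundamental theorem is
    stated for closed intervals.\<close>
  also have "\<dots> = (\<integral>\<^sup>+y. ennreal (exp (- y)) * indicator {L x..L b} y \<partial>lborel)"
    by (subst nn_integral_density, (simp; fail), (simp; fail), intro nn_integral_cong_AE)
       (use AE_lborel_singleton[of "L x"] in eventually_elim, auto split: split_indicator)
  also have "\<dots> = ennreal (- exp (- L b) - - exp (- L x))"
    by (rule nn_integral_FTC_Icc) (auto intro!: derivative_eq_intros LxLb)
  finally show ?thesis by simp
qed

end

text \<open>At time \<open>t\<close> the survival formula integrates over a single point and gives
  exp(0) = 1. This disposes of the indicator in front of the conditional expectation.\<close>

lemma (in prob_space) interaction_time_alive: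
  assumes "\<tau> \<in> borel_measurable M"
    and "prob {\<omega>\<in>space M. \<tau> \<omega> > ennreal t} = exp (- (LINT u:{t..t}|lborel. lam u))"
  shows "AE \<omega> in M. \<tau> \<omega> > ennreal t"
proof (subst prob_Collect_eq_1[symmetric])
  have "(LINT u:{t..t}|lborel. lam u) = 0"
    unfolding set_lebesgue_integral_def
    by (rule integral_eq_zero_AE, use AE_lborel_singleton[of t] in eventually_elim) auto
  then show "prob {\<omega>\<in>space M. \<tau> \<omega> > ennreal t} = 1" using assms(2) by simp
qed (use assms(1) in simp)

text \<open>Upper half-lines determine a measure that is finite on them, and on them the restricted
  law is a difference of two survival probabilities. The restriction to
  \<open>\<tau> \<le> T\<close> also removes \<open>\<tau> = \<infinity>\<close>, which
  \<open>enn2real\<close> would send to 0.\<close>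

lemma (in prob_space) interaction_time_law:
  assumes \<tau> [measurable]: "\<tau> \<in> borel_measurable M"
    and t: "0 \<le> t" "t \<le> T"
    and int: "set_integrable lborel {t..T} lam"
    and pos: "\<And>s. s \<in> {t..T} \<Longrightarrow> 0 < lam s"
    and surv: "\<And>s. s \<in> {t..T} \<Longrightarrow>
      prob {\<omega>\<in>space M. \<tau> \<omega> > ennreal s} = exp (- (LINT u:{t..s}|lborel. lam u))"
  shows "distr (density M (indicator {\<omega>\<in>space M. \<tau> \<omega> \<le> ennreal T})) borel (\<lambda>\<omega>. enn2real (\<tau> \<omega>))
    = density lborel (\<lambda>s. ennreal (indicator {t..T} s * lam s * exp (- (LINT u:{t..s}|lborel. lam u)))
        * indicator {t<..T} s)" (is "distr (density M ?I) _ _ = density lborel ?q")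
proof (rule measure_eqI_lessThan)
  define L where "L s = (LINT u:{t..s}|lborel. lam u)" for s
  note meas[measurable] = set_integrable_measurable[OF int]
    cumulative_intensity_measurable[OF t(2) int pos, folded L_def, simplified]
  have "?q = (\<lambda>s. ennreal (indicator {t..T} s * lam s * exp (- L (max t (min T s)))) * indicator {t<..T} s)"
    by (auto simp: fun_eq_iff L_def split: split_indicator)
  then have q[measurable]: "?q \<in> borel_measurable borel" by simp
  have alive: "AE \<omega> in M. ennreal t < \<tau> \<omega>"
    using surv[of t] t by (intro interaction_time_alive \<tau>) auto
  have eq: "emeasure (distr (density M ?I) borel (\<lambda>\<omega>. enn2real (\<tau> \<omega>))) {x<..}
      = emeasure (density lborel ?q) {x<..}" for x
  proof -
    \<comment> \<open>The restricted law lives on \<open>{t<..T}\<close>: a bound \<open>x\<close>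
      below \<open>t\<close> acts like \<open>t\<close> because \<open>\<tau> > t\<close> almost
      surely, and a bound above \<open>T\<close> like \<open>T\<close>, leaving the empty
      set.\<close>
    define y where "y = min T (max t x)"
    have y: "y \<in> {t..T}" using t by (auto simp: y_def)
    let ?S = "\<lambda>s. {\<omega>\<in>space M. \<tau> \<omega> > ennreal s}"
    have "emeasure (distr (density M ?I) borel (\<lambda>\<omega>. enn2real (\<tau> \<omega>))) {x<..}
        = (\<integral>\<^sup>+\<omega>. ?I \<omega> * indicator ((\<lambda>\<omega>. enn2real (\<tau> \<omega>)) -` {x<..} \<inter> space M) \<omega> \<partial>M)"
      by (subst emeasure_distr) (auto simp: emeasure_density)
    also have "\<dots> = (\<integral>\<^sup>+\<omega>. indicator (?S y - ?S T) \<omega> \<partial>M)"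
    proof (intro nn_integral_cong_AE, use alive in eventually_elim)
      fix \<omega> assume *: "ennreal t < \<tau> \<omega>"
      show "?I \<omega> * indicator ((\<lambda>\<omega>. enn2real (\<tau> \<omega>)) -` {x<..} \<inter> space M) \<omega> = (indicator (?S y - ?S T) \<omega> :: ennreal)"
        using * t by (cases "\<tau> \<omega>") (auto simp: y_def ennreal_less_iff top_unique split: split_indicator)
    qed
    also have "\<dots> = emeasure M (?S y - ?S T)" by (rule nn_integral_indicator) measurable
    also have "\<dots> = ennreal (prob (?S y) - prob (?S T))"
      unfolding emeasure_eq_measure using y t
      by (subst finite_measure_Diff) (auto intro: le_less_trans ennreal_leI)
    also have "\<dots> = ennreal (exp (- L y) - exp (- L T))"
      using surv[of y] surv[of T] y t by (simp add: L_def)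
    also have "\<dots> = (\<integral>\<^sup>+s. ennreal (indicator {t..T} s * lam s * exp (- L s)) * indicator {y<..T} s \<partial>lborel)"
      unfolding L_def by (rule nn_integral_exp_cumulative_intensity[OF t(2) int pos y, symmetric])
    also have "\<dots> = (\<integral>\<^sup>+s. ?q s * indicator {x<..} s \<partial>lborel)"
      by (intro nn_integral_cong) (auto simp: L_def y_def split: split_indicator)
    also have "\<dots> = emeasure (density lborel ?q) {x<..}"
      by (subst emeasure_density) auto
    finally show ?thesis .
  qed
  show "emeasure (distr (density M ?I) borel (\<lambda>\<omega>. enn2real (\<tau> \<omega>))) {x<..}
      = emeasure (density lborel ?q) {x<..}" for x by (rule eq)
  have "emeasure (distr (density M ?I) borel (\<lambda>\<omega>. enn2real (\<tau> \<omega>))) {x<..}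
      \<le> emeasure M (space M)" for x
  proof -
    have "emeasure (distr (density M ?I) borel (\<lambda>\<omega>. enn2real (\<tau> \<omega>))) {x<..}
        = (\<integral>\<^sup>+\<omega>. ?I \<omega> * indicator ((\<lambda>\<omega>. enn2real (\<tau> \<omega>)) -` {x<..} \<inter> space M) \<omega> \<partial>M)"
      by (subst emeasure_distr) (auto simp: emeasure_density)
    also have "\<dots> \<le> (\<integral>\<^sup>+\<omega>. 1 \<partial>M)" by (intro nn_integral_mono) (auto split: split_indicator)
    finally show ?thesis by simp
  qed
  then show "emeasure (distr (density M ?I) borel (\<lambda>\<omega>. enn2real (\<tau> \<omega>))) {x<..} < \<infinity>" for x
    by (rule le_less_trans) (simp add: emeasure_space_1)
qed auto

section \<open>Augmented filtrations, independence, and joint measurability\<close>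

lemma space_nat_filtration [simp]: "space (nat_filtration M W s) = space M"
  unfolding nat_filtration_def by (rule space_measure_of) auto

lemma sets_nat_filtration:
  "sets (nat_filtration M W s) =
    sigma_sets (space M) (\<Union>u\<in>{0..s}. {W u -` A \<inter> space M |A. A \<in> sets borel})"
  unfolding nat_filtration_def by (rule sets_measure_of) auto

lemma space_aug_filtration [simp]: "space (aug_filtration M W s) = space M"
  unfolding aug_filtration_def
  by (rule space_measure_of)
     (use sets.sets_into_space[of _ "nat_filtration M W s"] sets.sets_into_space[of _ M] in auto)

lemma sets_aug_filtration:
  "sets (aug_filtration M W s) = sigma_sets (space M) (sets (nat_filtration M W s) \<union> null_sets M)"
  unfolding aug_filtration_def
  by (rule sets_measure_of)
     (use sets.sets_into_space[of _ "nat_filtration M W s"] sets.sets_into_space[of _ M] in auto)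

lemma sets_aug_filtration_mono:
  assumes "s \<le> u"
  shows "sets (aug_filtration M W s) \<subseteq> sets (aug_filtration M W u)"
proof -
  have "sets (nat_filtration M W s) \<subseteq> sets (nat_filtration M W u)"
    unfolding sets_nat_filtration by (rule sigma_sets_mono') (use assms in force)
  then show ?thesis unfolding sets_aug_filtration by (intro sigma_sets_mono') auto
qed

lemma subalgebra_nat_filtration:
  assumes "\<And>u. u \<in> {0..s} \<Longrightarrow> W u \<in> borel_measurable M"
  shows "subalgebra M (nat_filtration M W s)"
  unfolding subalgebra_def sets_nat_filtration
  by (auto intro!: sets.sigma_sets_subset measurable_sets[OF assms])

lemma subalgebra_aug_filtration:
  assumes "\<And>u. u \<in> {0..s} \<Longrightarrow> W u \<in> borel_measurable M"
  shows "subalgebra M (aug_filtration M W s)"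
  using subalgebra_nat_filtration[of s W M, OF assms]
  unfolding subalgebra_def sets_aug_filtration
  by (auto intro!: sets.sigma_sets_subset)

text \<open>The sets that agree almost everywhere with some set of the natural filtration form a
  sigma-algebra, and it contains both families of generators; a null set is matched by the empty
  set.\<close>

lemma aug_filtration_AE_eq:
  assumes W: "\<And>u. u \<in> {0..s} \<Longrightarrow> W u \<in> borel_measurable M"
    and A: "A \<in> sets (aug_filtration M W s)"
  obtains B where "B \<in> sets (nat_filtration M W s)" "AE \<omega> in M. \<omega> \<in> A \<longleftrightarrow> \<omega> \<in> B"
proof -
  have "\<exists>B\<in>sets (nat_filtration M W s). AE \<omega> in M. \<omega> \<in> A \<longleftrightarrow> \<omega> \<in> B"
    using A unfolding sets_aug_filtration
  proof (induction rule: sigma_sets.induct)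
    case (Basic A)
    then show ?case
    proof
      assume "A \<in> null_sets M"
      then show ?thesis by (intro bexI[of _ "{}"]) (auto dest: AE_not_in)
    qed auto
  next
    case (Compl A)
    then obtain B where B: "B \<in> sets (nat_filtration M W s)" "AE \<omega> in M. \<omega> \<in> A \<longleftrightarrow> \<omega> \<in> B" by auto
    have "space M - B \<in> sets (nat_filtration M W s)"
      using sets.compl_sets[OF B(1)] by simp
    moreover have "AE \<omega> in M. \<omega> \<in> space M - A \<longleftrightarrow> \<omega> \<in> space M - B" using B(2) by eventually_elim auto
    ultimately show ?case by blast
  next
    case (Union A)
    then obtain B where B: "\<And>i::nat. B i \<in> sets (nat_filtration M W s)"
      "\<And>i. AE \<omega> in M. \<omega> \<in> A i \<longleftrightarrow> \<omega> \<in> B i" by metis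
    have "AE \<omega> in M. \<forall>i. \<omega> \<in> A i \<longleftrightarrow> \<omega> \<in> B i" using B(2) by (simp add: AE_all_countable)
    then have "AE \<omega> in M. \<omega> \<in> (\<Union>i. A i) \<longleftrightarrow> \<omega> \<in> (\<Union>i. B i)" by eventually_elim auto
    moreover have "(\<Union>i. B i) \<in> sets (nat_filtration M W s)" using B(1) by auto
    ultimately show ?case by blast
  qed auto
  then show thesis using that by blast
qed

text \<open>Replacing an augmented event by an almost surely equal event of the natural filtration
  changes no probability in the product formula.\<close>

lemma (in prob_space) indep_set_aug_filtration:
  assumes W: "\<And>u. u \<in> {0..s} \<Longrightarrow> W u \<in> borel_measurable M"
    and indep: "indep_set (sets (nat_filtration M W s)) \<B>" and "\<B> \<subseteq> events"
  shows "indep_set (sets (aug_filtration M W s)) \<B>"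
proof (rule indep_setI)
  have aug: "subalgebra M (aug_filtration M W s)" and nat: "subalgebra M (nat_filtration M W s)"
    by (rule subalgebra_aug_filtration subalgebra_nat_filtration, rule W, assumption)+
  then show "sets (aug_filtration M W s) \<subseteq> events" by (simp add: subalgebra_def)
  fix A B assume A: "A \<in> sets (aug_filtration M W s)" and B: "B \<in> \<B>"
  obtain A' where A': "A' \<in> sets (nat_filtration M W s)" "AE \<omega> in M. \<omega> \<in> A \<longleftrightarrow> \<omega> \<in> A'"
    using aug_filtration_AE_eq[OF W A] by blast
  have [measurable]: "A \<in> events" "A' \<in> events" "B \<in> events"
    using aug nat A A'(1) B assms(3) by (auto simp: subalgebra_def)
  have "prob (A \<inter> B) = prob (A' \<inter> B)"
    by (rule finite_measure_eq_AE) (use A'(2) in \<open>eventually_elim, auto\<close>)+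
  also have "\<dots> = prob A' * prob B" by (rule indep_setD[OF indep A'(1) B])
  also have "prob A' = prob A"
    by (rule finite_measure_eq_AE) (use A'(2) in \<open>eventually_elim, auto\<close>)+
  finally show "prob (A \<inter> B) = prob A * prob B" .
qed fact

text \<open>This is the freezing lemma. The identity, viewed as a map from \<open>M\<close> to
  \<open>N\<close>, is a random variable generating \<open>N\<close>; by independence its joint law
  with \<open>\<tau>\<close> is the product of the marginals, and Tonelli's theorem gives the
  iterated integral.\<close>

lemma (in prob_space) nn_integral_indep_subalgebra:
  assumes \<tau> [measurable]: "\<tau> \<in> measurable M S" and N: "subalgebra M N"
    and indep: "indep_set (sets N) (sets (vimage_algebra (space M) \<tau> S))"
    and K [measurable]: "K \<in> borel_measurable (S \<Otimes>\<^sub>M N)"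
  shows "(\<integral>\<^sup>+\<omega>. K (\<tau> \<omega>, \<omega>) \<partial>M) = (\<integral>\<^sup>+\<omega>'. (\<integral>\<^sup>+\<omega>. K (\<tau> \<omega>', \<omega>) \<partial>M) \<partial>M)"
proof -
  have id [measurable]: "(\<lambda>\<omega>. \<omega>) \<in> measurable M N"
    using N by (auto simp: subalgebra_def measurable_def)
  have space: "space N = space M" using N by (simp add: subalgebra_def)
  interpret D: prob_space "distr M N (\<lambda>\<omega>. \<omega>)" by (rule prob_space_distr) simp
  interpret E: prob_space "distr M S \<tau>" by (rule prob_space_distr) simp
  have prod: "distr M S \<tau> \<Otimes>\<^sub>M distr M N (\<lambda>\<omega>. \<omega>) = distr M (S \<Otimes>\<^sub>M N) (\<lambda>\<omega>. (\<tau> \<omega>, \<omega>))"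
  proof (rule pair_measure_eqI)
    fix A B assume "A \<in> sets (distr M S \<tau>)" "B \<in> sets (distr M N (\<lambda>\<omega>. \<omega>))"
    then have AB [measurable]: "A \<in> sets S" "B \<in> sets N" by auto
    have "B \<in> events" using AB(2) N by (auto simp: subalgebra_def)
    then have [simp]: "B \<inter> space M = B" using sets.sets_into_space[of B M] by auto
    have "\<tau> -` A \<inter> space M \<in> sets (vimage_algebra (space M) \<tau> S)"
      using AB(1) by (rule in_vimage_algebra)
    then have "prob (B \<inter> (\<tau> -` A \<inter> space M)) = prob B * prob (\<tau> -` A \<inter> space M)"
      by (rule indep_setD[OF indep AB(2)])
    moreover have "(\<lambda>\<omega>. (\<tau> \<omega>, \<omega>)) -` (A \<times> B) \<inter> space M = B \<inter> (\<tau> -` A \<inter> space M)"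
      by auto
    ultimately show "emeasure (distr M S \<tau>) A * emeasure (distr M N (\<lambda>\<omega>. \<omega>)) B
        = emeasure (distr M (S \<Otimes>\<^sub>M N) (\<lambda>\<omega>. (\<tau> \<omega>, \<omega>))) (A \<times> B)"
      by (simp add: emeasure_distr emeasure_eq_measure mult.commute flip: ennreal_mult)
  qed (auto intro: E.sigma_finite_measure_axioms D.sigma_finite_measure_axioms)
  have "(\<integral>\<^sup>+\<omega>. K (\<tau> \<omega>, \<omega>) \<partial>M) = (\<integral>\<^sup>+p. K p \<partial>distr M (S \<Otimes>\<^sub>M N) (\<lambda>\<omega>. (\<tau> \<omega>, \<omega>)))"
    by (subst nn_integral_distr) auto
  also have "\<dots> = (\<integral>\<^sup>+x. (\<integral>\<^sup>+\<omega>. K (x, \<omega>) \<partial>distr M N (\<lambda>\<omega>. \<omega>)) \<partial>distr M S \<tau>)"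
    unfolding prod[symmetric] by (rule D.nn_integral_fst[symmetric]) simp
  also have "\<dots> = (\<integral>\<^sup>+\<omega>'. (\<integral>\<^sup>+\<omega>. K (\<tau> \<omega>', \<omega>) \<partial>distr M N (\<lambda>\<omega>. \<omega>)) \<partial>M)"
    by (subst nn_integral_distr) auto
  also have "\<dots> = (\<integral>\<^sup>+\<omega>'. (\<integral>\<^sup>+\<omega>. K (\<tau> \<omega>', \<omega>) \<partial>M) \<partial>M)"
    by (intro nn_integral_cong nn_integral_distr) (auto intro: measurable_compose[OF measurable_Pair2' K] measurable_space[OF \<tau>])
  finally show ?thesis .
qed

section \<open>Joint measurability of continuous processes\<close>

lemma borel_measurable_vec_componentwise:
  fixes h :: "'a \<Rightarrow> real^'n"
  assumes "\<And>i. (\<lambda>\<omega>. h \<omega> $ i) \<in> borel_measurable N"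
  shows "h \<in> borel_measurable N"
  by (subst borel_measurable_euclidean_space) (auto simp: Basis_vec_def inner_axis assms)

text \<open>Rounding time down to a grid of mesh 1/(n+1) leaves countably many fixed times, so the
  rounded process is jointly measurable; by continuity of the paths it converges pointwise to
  \<open>X\<close>.\<close>

lemma borel_measurable_continuous_process:
  fixes X :: "real \<Rightarrow> 'a \<Rightarrow> 'b::metric_space"
  assumes [measurable]: "\<And>u. X u \<in> borel_measurable N"
    and cont: "\<And>\<omega>. \<omega> \<in> space N \<Longrightarrow> continuous_on UNIV (\<lambda>u. X u \<omega>)"
  shows "(\<lambda>(u, \<omega>). X u \<omega>) \<in> borel_measurable (borel \<Otimes>\<^sub>M N)"
proof (rule borel_measurable_LIMSEQ_metric)
  define g where "g n u = of_int \<lfloor>u * real (Suc n)\<rfloor> / real (Suc n)" for n :: nat and u :: real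
  show "(\<lambda>(u, \<omega>). X (g n u) \<omega>) \<in> borel_measurable (borel \<Otimes>\<^sub>M N)" for n
  proof -
    have "(\<lambda>p. X (of_int \<lfloor>fst p * real (Suc n)\<rfloor> / real (Suc n)) (snd p)) \<in> borel_measurable (borel \<Otimes>\<^sub>M N)"
      by (rule measurable_compose_countable'[where I=UNIV and g="\<lambda>p. \<lfloor>fst p * real (Suc n)\<rfloor>"
            and f="\<lambda>i p. X (of_int i / real (Suc n)) (snd p)"]) auto
    then show ?thesis by (simp add: g_def case_prod_beta)
  qed
  fix p :: "real \<times> 'a" assume p: "p \<in> space (borel \<Otimes>\<^sub>M N)"
  obtain u \<omega> where [simp]: "p = (u, \<omega>)" by (cases p)
  have "(\<lambda>n. g n u) \<longlonglongrightarrow> u"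
  proof (rule LIMSEQ_I)
    fix r :: real assume "0 < r"
    then obtain k where k: "inverse (real (Suc k)) < r" using reals_Archimedean by blast
    have "norm (g n u - u) < r" if "k \<le> n" for n
    proof -
      have "\<bar>of_int \<lfloor>u * real (Suc n)\<rfloor> - u * real (Suc n)\<bar> \<le> 1" by linarith
      moreover have "norm (g n u - u) = \<bar>of_int \<lfloor>u * real (Suc n)\<rfloor> - u * real (Suc n)\<bar> / real (Suc n)"
        by (simp add: g_def field_simps flip: abs_div_pos del: of_nat_Suc)
      ultimately have "norm (g n u - u) \<le> inverse (real (Suc n))"
        by (simp add: g_def divide_simps del: of_nat_Suc)
      also have "\<dots> \<le> inverse (real (Suc k))" using that by simp
      finally show ?thesis using k by simp
    qed
    then show "\<exists>no. \<forall>n\<ge>no. norm (g n u - u) < r" by blast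
  qed
  moreover have "isCont (\<lambda>u. X u \<omega>) u"
    using cont[of \<omega>] p by (simp add: space_pair_measure continuous_on_eq_continuous_at)
  ultimately have "(\<lambda>n. X (g n u) \<omega>) \<longlonglongrightarrow> X u \<omega>" by (rule isCont_tendsto_compose[rotated])
  then show "(\<lambda>n. case p of (u, \<omega>) \<Rightarrow> X (g n u) \<omega>) \<longlonglongrightarrow> (case p of (u, \<omega>) \<Rightarrow> X u \<omega>)" by simp
qed

section \<open>Jointly measurable conditional expectations\<close>

context sigma_finite_subalgebra
begin

lemma nn_set_integral_nn_cond_exp:
  assumes "A \<in> sets F" "f \<in> borel_measurable M"
  shows "(\<integral>\<^sup>+\<omega>\<in>A. nn_cond_exp M F f \<omega> \<partial>M) = (\<integral>\<^sup>+\<omega>\<in>A. f \<omega> \<partial>M)"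
  using nn_cond_exp_intg[of "indicator A" f] assms by (simp add: mult.commute)

lemma nn_cond_exp_suminf:
  assumes [measurable]: "\<And>i. f i \<in> borel_measurable M"
  shows "AE \<omega> in M. (\<Sum>i. nn_cond_exp M F (f i) \<omega>) = nn_cond_exp M F (\<lambda>\<omega>. \<Sum>i. f i \<omega>) \<omega>"
proof (rule nn_cond_exp_charact)
  fix A assume A: "A \<in> sets F"
  then have [measurable]: "A \<in> sets M" using subalg by (auto simp: subalgebra_def)
  have "(\<integral>\<^sup>+\<omega>\<in>A. (\<Sum>i. f i \<omega>) \<partial>M) = (\<Sum>i. \<integral>\<^sup>+\<omega>\<in>A. f i \<omega> \<partial>M)"
    by (simp flip: ennreal_suminf_multc add: nn_integral_suminf)
  also have "\<dots> = (\<Sum>i. \<integral>\<^sup>+\<omega>\<in>A. nn_cond_exp M F (f i) \<omega> \<partial>M)"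
    by (simp add: nn_set_integral_nn_cond_exp A)
  also have "\<dots> = (\<integral>\<^sup>+\<omega>\<in>A. (\<Sum>i. nn_cond_exp M F (f i) \<omega>) \<partial>M)"
    by (simp flip: ennreal_suminf_multc add: nn_integral_suminf)
  finally show "(\<integral>\<^sup>+\<omega>\<in>A. (\<Sum>i. f i \<omega>) \<partial>M) = (\<integral>\<^sup>+\<omega>\<in>A. (\<Sum>i. nn_cond_exp M F (f i) \<omega>) \<partial>M)" .
qed auto

text \<open>The conditional expectations of an increasing sequence increase only almost surely,
  hence the almost-everywhere form of monotone convergence.\<close>

lemma nn_cond_exp_SUP:
  assumes [measurable]: "\<And>i. f i \<in> borel_measurable M" and "\<And>\<omega>. \<omega> \<in> space M \<Longrightarrow> incseq (\<lambda>i. f i \<omega>)"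
  shows "AE \<omega> in M. (SUP i. nn_cond_exp M F (f i) \<omega>) = nn_cond_exp M F (\<lambda>\<omega>. SUP i. f i \<omega>) \<omega>"
proof (rule nn_cond_exp_charact)
  fix A assume A: "A \<in> sets F"
  then have [measurable]: "A \<in> sets M" using subalg by (auto simp: subalgebra_def)
  have f: "AE \<omega> in M. f i \<omega> \<le> f (Suc i) \<omega>" for i
    using assms(2) by (auto simp: incseq_def)
  have Y: "AE \<omega> in M. nn_cond_exp M F (f i) \<omega> \<le> nn_cond_exp M F (f (Suc i)) \<omega>" for i
    by (rule nn_cond_exp_mono[OF f]) auto
  have SUP_A: "(\<integral>\<^sup>+\<omega>\<in>A. (SUP i. g i \<omega>) \<partial>M) = (SUP i. \<integral>\<^sup>+\<omega>\<in>A. g i \<omega> \<partial>M)"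
    if "\<And>i. AE \<omega> in M. g i \<omega> \<le> g (Suc i) \<omega>" and [measurable]: "\<And>i. g i \<in> borel_measurable M"
    for g :: "nat \<Rightarrow> 'a \<Rightarrow> ennreal"
  proof -
    have "(\<integral>\<^sup>+\<omega>\<in>A. (SUP i. g i \<omega>) \<partial>M) = (\<integral>\<^sup>+\<omega>. (SUP i. g i \<omega> * indicator A \<omega>) \<partial>M)"
      by (intro nn_integral_cong) (auto split: split_indicator)
    also have "\<dots> = (SUP i. \<integral>\<^sup>+\<omega>\<in>A. g i \<omega> \<partial>M)"
    proof (rule nn_integral_monotone_convergence_SUP_AE)
      show "AE \<omega> in M. g i \<omega> * indicator A \<omega> \<le> g (Suc i) \<omega> * indicator A \<omega>" for i
        using that(1)[of i] by eventually_elim (auto split: split_indicator)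
    qed auto
    finally show ?thesis .
  qed
  show "(\<integral>\<^sup>+\<omega>\<in>A. (SUP i. f i \<omega>) \<partial>M) = (\<integral>\<^sup>+\<omega>\<in>A. (SUP i. nn_cond_exp M F (f i) \<omega>) \<partial>M)"
    by (simp add: SUP_A f Y nn_set_integral_nn_cond_exp A)
qed auto

text \<open>
  The exceptional null set depends on \<open>u\<close>; this lets a monotone class argument from rectangles
  replace the separability of \<open>F\<close>, which fails for augmented filtrations.
\<close>

lemma nn_cond_exp_indicator_jointly_measurable:
  assumes "A \<in> sets (S \<Otimes>\<^sub>M M)"
  shows "\<exists>Y\<in>borel_measurable (S \<Otimes>\<^sub>M F). \<forall>u\<in>space S.
    AE \<omega> in M. Y (u, \<omega>) = nn_cond_exp M F (\<lambda>\<omega>. indicator A (u, \<omega>)) \<omega>"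
  \<comment> \<open>Rectangles are stable under intersection, so the induction has to treat only
    disjoint unions, where indicators add up and countable additivity of conditional expectations
    applies.\<close>
  using Int_stable_pair_measure_generator pair_measure_closed assms unfolding sets_pair_measure
proof (induction A rule: sigma_sets_induct_disjoint)
  case (basic A)
  then obtain a b where [simp]: "A = a \<times> b" and [measurable]: "a \<in> sets S" "b \<in> sets M" by auto
  let ?Y = "\<lambda>(u, \<omega>). indicator a u * nn_cond_exp M F (indicator b) \<omega>"
  have "AE \<omega> in M. ?Y (u, \<omega>) = nn_cond_exp M F (\<lambda>\<omega>. indicator A (u, \<omega>)) \<omega>" for u
    using nn_cond_exp_prod[of "\<lambda>_. indicator a u" "indicator b"] by (simp add: indicator_times)
  then show ?case by (intro bexI[of _ ?Y]) auto
next
  case empty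
  have "AE \<omega> in M. 0 = nn_cond_exp M F (\<lambda>\<omega>. 0) \<omega>" by (rule nn_cond_exp_charact) auto
  then show ?case by (intro bexI[of _ "\<lambda>_. 0"]) auto
next
  case (compl A)
  then have A [measurable]: "A \<in> sets (S \<Otimes>\<^sub>M M)" by (simp add: sets_pair_measure)
  obtain Y where [measurable]: "Y \<in> borel_measurable (S \<Otimes>\<^sub>M F)"
    and Y: "\<And>u. u \<in> space S \<Longrightarrow> AE \<omega> in M. Y (u, \<omega>) = nn_cond_exp M F (\<lambda>\<omega>. indicator A (u, \<omega>)) \<omega>"
    using compl.IH by blast
  have "AE \<omega> in M. 1 - Y (u, \<omega>) = nn_cond_exp M F (\<lambda>\<omega>. indicator (space S \<times> space M - A) (u, \<omega>)) \<omega>"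
    if [measurable]: "u \<in> space S" for u
  proof -
    let ?A = "\<lambda>\<omega>. indicator A (u, \<omega>) :: ennreal"
    let ?B = "\<lambda>\<omega>. indicator (space S \<times> space M - A) (u, \<omega>) :: ennreal"
    have [measurable]: "space S \<times> space M - A \<in> sets (S \<Otimes>\<^sub>M M)"
      using sets.compl_sets[OF A] by (simp add: space_pair_measure)
    have [measurable]: "?A \<in> borel_measurable M" "?B \<in> borel_measurable M"
      using that by (auto intro!: measurable_compose[OF measurable_Pair1'])
    have const: "AE \<omega> in M. 1 = nn_cond_exp M F (\<lambda>_. 1) \<omega>" by (rule nn_cond_exp_charact) auto
    have cong: "AE \<omega> in M. nn_cond_exp M F (\<lambda>\<omega>. ?A \<omega> + ?B \<omega>) \<omega> = nn_cond_exp M F (\<lambda>_. 1) \<omega>"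
      by (rule nn_cond_exp_cong) (use that in \<open>auto split: split_indicator\<close>)
    have "AE \<omega> in M. nn_cond_exp M F ?A \<omega> + nn_cond_exp M F ?B \<omega> = nn_cond_exp M F (\<lambda>\<omega>. ?A \<omega> + ?B \<omega>) \<omega>"
      by (rule nn_cond_exp_sum) auto
    then show ?thesis using const cong Y[OF that]
    proof eventually_elim
      case (elim \<omega>)
      then have "nn_cond_exp M F ?A \<omega> + nn_cond_exp M F ?B \<omega> = 1" by simp
      \<comment> \<open>Subtraction of extended reals cancels finite terms only; finiteness follows
        from the two conditional expectations summing to 1.\<close>
      moreover from this have "nn_cond_exp M F ?A \<omega> \<noteq> \<top>" by auto
      ultimately show ?case using elim ennreal_add_diff_cancel_left by metis
    qed
  qed
  then show ?case by (intro bexI[of _ "\<lambda>p. 1 - Y p"]) auto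
next
  case (union A)
  then have A [measurable]: "\<And>i. A i \<in> sets (S \<Otimes>\<^sub>M M)" by (auto simp: sets_pair_measure)
  obtain Y where [measurable]: "\<And>i. Y i \<in> borel_measurable (S \<Otimes>\<^sub>M F)"
    and Y: "\<And>i u. u \<in> space S \<Longrightarrow> AE \<omega> in M. Y i (u, \<omega>) = nn_cond_exp M F (\<lambda>\<omega>. indicator (A i) (u, \<omega>)) \<omega>"
    using union.IH by metis
  have "AE \<omega> in M. (\<Sum>i. Y i (u, \<omega>)) = nn_cond_exp M F (\<lambda>\<omega>. indicator (\<Union>i. A i) (u, \<omega>)) \<omega>"
    if [measurable]: "u \<in> space S" for u
  proof -
    have [measurable]: "(\<lambda>\<omega>. indicator (A i) (u, \<omega>) :: ennreal) \<in> borel_measurable M" for i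
      using that by (auto intro!: measurable_compose[OF measurable_Pair1'])
    have "AE \<omega> in M. \<forall>i. Y i (u, \<omega>) = nn_cond_exp M F (\<lambda>\<omega>. indicator (A i) (u, \<omega>)) \<omega>"
      using Y[OF that] by (simp add: AE_all_countable)
    moreover have "AE \<omega> in M. (\<Sum>i. nn_cond_exp M F (\<lambda>\<omega>. indicator (A i) (u, \<omega>)) \<omega>)
        = nn_cond_exp M F (\<lambda>\<omega>. \<Sum>i. indicator (A i) (u, \<omega>)) \<omega>"
      by (rule nn_cond_exp_suminf) simp
    ultimately show ?thesis
      unfolding suminf_indicator[OF union.hyps(1)] by eventually_elim simp
  qed
  then show ?case by (intro bexI[of _ "\<lambda>p. \<Sum>i. Y i p"]) auto
qed

text \<open>Scaling, sums and increasing limits commute with conditional expectation for each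
  \<open>u\<close> separately, and applied to the versions they preserve joint
  measurability.\<close>

lemma nn_cond_exp_jointly_measurable:
  assumes "H \<in> borel_measurable (S \<Otimes>\<^sub>M M)"
  shows "\<exists>Y\<in>borel_measurable (S \<Otimes>\<^sub>M F). \<forall>u\<in>space S.
    AE \<omega> in M. Y (u, \<omega>) = nn_cond_exp M F (\<lambda>\<omega>. H (u, \<omega>)) \<omega>"
  using assms
proof (induction H rule: borel_measurable_induct)
  case (cong g f)
  from cong.IH obtain Y where Y1: "Y \<in> borel_measurable (S \<Otimes>\<^sub>M F)"
    and Y2: "\<forall>u\<in>space S. AE \<omega> in M. Y (u, \<omega>) = nn_cond_exp M F (\<lambda>\<omega>. f (u, \<omega>)) \<omega>" by (rule bexE)
  note Y = Y1 Y2[rule_format]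
  have "AE \<omega> in M. Y (u, \<omega>) = nn_cond_exp M F (\<lambda>\<omega>. g (u, \<omega>)) \<omega>" if u: "u \<in> space S" for u
  proof -
    have "AE \<omega> in M. nn_cond_exp M F (\<lambda>\<omega>. f (u, \<omega>)) \<omega> = nn_cond_exp M F (\<lambda>\<omega>. g (u, \<omega>)) \<omega>"
      by (rule nn_cond_exp_cong)
         (use cong u in \<open>auto simp: space_pair_measure intro!: measurable_compose[OF measurable_Pair1']\<close>)
    with Y(2)[OF u] show ?thesis by eventually_elim simp
  qed
  with Y(1) show ?case by blast
next
  case (set A)
  then show ?case by (rule nn_cond_exp_indicator_jointly_measurable)
next
  case (mult f c)
  from mult.IH obtain Y where [measurable]: "Y \<in> borel_measurable (S \<Otimes>\<^sub>M F)" and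
    Y: "\<forall>u\<in>space S. AE \<omega> in M. Y (u, \<omega>) = nn_cond_exp M F (\<lambda>\<omega>. f (u, \<omega>)) \<omega>" by (rule bexE)
  note Y = Y[rule_format]
  have "AE \<omega> in M. c * Y (u, \<omega>) = nn_cond_exp M F (\<lambda>\<omega>. c * f (u, \<omega>)) \<omega>" if u: "u \<in> space S" for u
  proof -
    have [measurable]: "(\<lambda>\<omega>. f (u, \<omega>)) \<in> borel_measurable M"
      using mult u by (auto intro!: measurable_compose[OF measurable_Pair1'])
    from nn_cond_exp_prod[of "\<lambda>_. c" "\<lambda>\<omega>. f (u, \<omega>)"] Y[OF u] show ?thesis
      by simp (elim AE_mp, auto)
  qed
  then show ?case by (intro bexI[of _ "\<lambda>p. c * Y p"]) auto
next
  case (add f g)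
  from add.IH(1) obtain Y where [measurable]: "Y \<in> borel_measurable (S \<Otimes>\<^sub>M F)" and
    Y: "\<forall>u\<in>space S. AE \<omega> in M. Y (u, \<omega>) = nn_cond_exp M F (\<lambda>\<omega>. f (u, \<omega>)) \<omega>" by (rule bexE)
  from add.IH(2) obtain Z where [measurable]: "Z \<in> borel_measurable (S \<Otimes>\<^sub>M F)" and
    Z: "\<forall>u\<in>space S. AE \<omega> in M. Z (u, \<omega>) = nn_cond_exp M F (\<lambda>\<omega>. g (u, \<omega>)) \<omega>" by (rule bexE)
  note Y = Y[rule_format] and Z = Z[rule_format]
  have "AE \<omega> in M. Z (u, \<omega>) + Y (u, \<omega>) = nn_cond_exp M F (\<lambda>\<omega>. g (u, \<omega>) + f (u, \<omega>)) \<omega>"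
    if u: "u \<in> space S" for u
  proof -
    have [measurable]: "(\<lambda>\<omega>. f (u, \<omega>)) \<in> borel_measurable M" "(\<lambda>\<omega>. g (u, \<omega>)) \<in> borel_measurable M"
      using add u by (auto intro!: measurable_compose[OF measurable_Pair1'])
    from nn_cond_exp_sum[of "\<lambda>\<omega>. g (u, \<omega>)" "\<lambda>\<omega>. f (u, \<omega>)"] Y[OF u] Z[OF u] show ?thesis by auto
  qed
  then show ?case by (intro bexI[of _ "\<lambda>p. Z p + Y p"]) auto
next
  case (seq U)
  obtain Y where [measurable]: "\<And>i. Y i \<in> borel_measurable (S \<Otimes>\<^sub>M F)" and
    Y: "\<And>i u. u \<in> space S \<Longrightarrow> AE \<omega> in M. Y i (u, \<omega>) = nn_cond_exp M F (\<lambda>\<omega>. U i (u, \<omega>)) \<omega>" using seq.IH by metis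
  have "AE \<omega> in M. (SUP i. Y i (u, \<omega>)) = nn_cond_exp M F (\<lambda>\<omega>. (SUP i. U i) (u, \<omega>)) \<omega>"
    if u: "u \<in> space S" for u
  proof -
    have [measurable]: "(\<lambda>\<omega>. U i (u, \<omega>)) \<in> borel_measurable M" for i
      using seq u by (auto intro!: measurable_compose[OF measurable_Pair1'])
    have "incseq (\<lambda>i. U i p)" for p using \<open>incseq U\<close> by (cases p) (simp add: incseq_def le_fun_def)
    then have *: "AE \<omega> in M. (SUP i. nn_cond_exp M F (\<lambda>\<omega>. U i (u, \<omega>)) \<omega>)
        = nn_cond_exp M F (\<lambda>\<omega>. SUP i. U i (u, \<omega>)) \<omega>" by (intro nn_cond_exp_SUP) auto
    have "AE \<omega> in M. \<forall>i. Y i (u, \<omega>) = nn_cond_exp M F (\<lambda>\<omega>. U i (u, \<omega>)) \<omega>"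
      using Y[OF u] by (simp add: AE_all_countable)
    with * show ?thesis by (auto simp: image_comp)
  qed
  then show ?case by (intro bexI[of _ "\<lambda>p. SUP i. Y i p"]) auto
qed

text \<open>By definition \<open>real_cond_exp\<close> is the difference of the real parts of two
  nonnegative conditional expectations. The same formula in jointly measurable versions therefore
  works at every \<open>u\<close>, also where \<open>G u\<close> is not integrable.\<close>

lemma real_cond_exp_jointly_measurable:
  assumes [measurable]: "(\<lambda>(u, \<omega>). G u \<omega>) \<in> borel_measurable (S \<Otimes>\<^sub>M M)"
  obtains Y where "(\<lambda>(u, \<omega>). Y u \<omega>) \<in> borel_measurable (S \<Otimes>\<^sub>M F)"
    "\<And>u. u \<in> space S \<Longrightarrow> AE \<omega> in M. Y u \<omega> = real_cond_exp M F (G u) \<omega>"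
proof -
  obtain Y where [measurable]: "Y \<in> borel_measurable (S \<Otimes>\<^sub>M F)"
    and Y: "\<And>u. u \<in> space S \<Longrightarrow> AE \<omega> in M. Y (u, \<omega>) = nn_cond_exp M F (\<lambda>\<omega>. ennreal (G u \<omega>)) \<omega>"
    using nn_cond_exp_jointly_measurable[of "\<lambda>(u, \<omega>). ennreal (G u \<omega>)" S] by (auto simp: case_prod_beta)
  obtain Z where [measurable]: "Z \<in> borel_measurable (S \<Otimes>\<^sub>M F)"
    and Z: "\<And>u. u \<in> space S \<Longrightarrow> AE \<omega> in M. Z (u, \<omega>) = nn_cond_exp M F (\<lambda>\<omega>. ennreal (- G u \<omega>)) \<omega>"
    using nn_cond_exp_jointly_measurable[of "\<lambda>(u, \<omega>). ennreal (- G u \<omega>)" S] by (auto simp: case_prod_beta)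
  show thesis
  proof (rule that[of "\<lambda>u \<omega>. enn2real (Y (u, \<omega>)) - enn2real (Z (u, \<omega>))"])
    show "AE \<omega> in M. enn2real (Y (u, \<omega>)) - enn2real (Z (u, \<omega>)) = real_cond_exp M F (G u) \<omega>"
      if "u \<in> space S" for u
      using Y[OF that] Z[OF that] by eventually_elim (simp add: real_cond_exp_def)
  qed simp
qed

end

section \<open>Randomisation of the time integral\<close>

text \<open>\<open>N\<close> carries the integrand. Taken as \<open>F T\<close>, it lets the
  integrand see the path up to the horizon while remaining independent of \<open>\<tau>\<close>;
  conditioning is on a smaller sigma-algebra.\<close>

locale independent_interaction_time = prob_space M
  for M :: "'a measure" and N :: "'a measure" and T t :: real and lam :: "real \<Rightarrow> real"
    and \<tau> :: "'a \<Rightarrow> ennreal" +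
  assumes N: "subalgebra M N"
    and \<tau> [measurable]: "\<tau> \<in> borel_measurable M"
    and indep: "indep_set (sets N) (sets (vimage_algebra (space M) \<tau> borel))"
    and t: "0 \<le> t" "t \<le> T"
    and int: "set_integrable lborel {0..T} lam"
    and pos: "\<And>s. s \<in> {0..T} \<Longrightarrow> 0 < lam s"
    and surv: "\<And>s. s \<in> {t..T} \<Longrightarrow>
      prob {\<omega>\<in>space M. \<tau> \<omega> > ennreal s} = exp (- (LINT u:{t..s}|lborel. lam u))"
begin

lemma set_integrable_lam: "set_integrable lborel {t..T} lam"
  by (rule set_integrable_subset[OF int]) (use t in auto)

lemma lam_pos: "s \<in> {t..T} \<Longrightarrow> 0 < lam s"
  using t pos by auto

section \<open>The density of the interaction time and the weight that cancels it\<close>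

definition cum_intensity :: "real \<Rightarrow> real" where
  "cum_intensity s = (LINT u:{t..s}|lborel. lam u)"

lemma cum_intensity_empty: "s \<le> t \<Longrightarrow> cum_intensity s = 0"
  unfolding cum_intensity_def set_lebesgue_integral_def
  by (rule integral_eq_zero_AE, use AE_lborel_singleton[of t] in eventually_elim)
     (auto split: split_indicator)

text \<open>The indicator makes \<open>weight\<close> Borel, as \<open>lam\<close> is only known to be measurable on \<open>{0..T}\<close>.\<close>

definition weight :: "real \<Rightarrow> real" where
  "weight s = 1 / (indicator {0..T} s * lam s) * exp (cum_intensity (max t (min T s)))"

text \<open>Times before \<open>t\<close> are covered as well: \<open>\<tau>\<close> may fall there
  on a null event, and the later identification with \<open>f_hat\<close> is pointwise. On these
  times both exponentials equal 1.\<close>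

lemma weight_eq: "s \<in> {0..T} \<Longrightarrow> weight s = 1 / lam s * exp (LINT u:{t..s}|lborel. lam u)"
  using cum_intensity_empty[of s] cum_intensity_empty[of t] by (cases "s \<le> t") (auto simp: weight_def cum_intensity_def)

lemma weight_nonneg: "0 \<le> weight s"
  using pos by (auto simp: weight_def less_imp_le split: split_indicator)

lemma cum_intensity_measurable [measurable]: "(\<lambda>s. cum_intensity (max t (min T s))) \<in> borel_measurable borel"
  using cumulative_intensity_measurable[OF t(2) set_integrable_lam lam_pos] unfolding cum_intensity_def .

lemma weight_measurable [measurable]: "weight \<in> borel_measurable borel"
proof -
  note [measurable] = set_integrable_measurable[OF int]
  show ?thesis unfolding weight_def by measurable
qed

definition law_density :: "real \<Rightarrow> ennreal" where
  "law_density s = ennreal (indicator {t..T} s * lam s * exp (- cum_intensity s)) * indicator {t<..T} s"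

lemma law_density_eq:
  "law_density s = ennreal (indicator {t..T} s * lam s * exp (- cum_intensity (max t (min T s)))) * indicator {t<..T} s"
  by (auto simp: law_density_def split: split_indicator)

lemma law_density_measurable [measurable]: "law_density \<in> borel_measurable borel"
proof -
  note [measurable] = set_integrable_measurable[OF set_integrable_lam]
  show ?thesis unfolding law_density_eq[abs_def] by measurable
qed

lemma law_density_weight: "law_density s * ennreal (weight s) = indicator {t<..T} s"
proof (cases "s \<in> {t<..T}")
  case True
  then have "s \<in> {0..T}" "0 < lam s" using t pos by auto
  with True have "law_density s * ennreal (weight s) = ennreal (lam s * exp (- cum_intensity s) * (1 / lam s * exp (cum_intensity s)))"
    by (simp add: law_density_def weight_eq flip: cum_intensity_def ennreal_mult)
  also have "lam s * exp (- cum_intensity s) * (1 / lam s * exp (cum_intensity s)) = 1"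
    using \<open>0 < lam s\<close> by (simp add: exp_minus)
  finally show ?thesis using True by simp
qed (simp add: law_density_def)

lemma measurable_subalgebra_pair:
  assumes "H \<in> measurable (S \<Otimes>\<^sub>M N) K"
  shows "H \<in> measurable (S \<Otimes>\<^sub>M M) K"
proof -
  have [measurable]: "(\<lambda>\<omega>. \<omega>) \<in> measurable M N"
    using N by (auto simp: subalgebra_def measurable_def)
  have "(\<lambda>p. (fst p, snd p)) \<in> measurable (S \<Otimes>\<^sub>M M) (S \<Otimes>\<^sub>M N)" by measurable
  then show ?thesis using measurable_compose[OF _ assms] by simp
qed

text \<open>Independence freezes \<open>\<tau>\<close> in the inner expectation; what remains is a
  function of \<open>\<tau>\<close> alone and is integrated against its law on
  \<open>\<tau> \<le> T\<close>.\<close>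

lemma nn_integral_interaction_time:
  assumes H [measurable]: "H \<in> borel_measurable (borel \<Otimes>\<^sub>M N)"
  shows "(\<integral>\<^sup>+\<omega>. indicator {\<omega>\<in>space M. \<tau> \<omega> \<le> ennreal T} \<omega> * H (enn2real (\<tau> \<omega>), \<omega>) \<partial>M)
    = (\<integral>\<^sup>+s. law_density s * (\<integral>\<^sup>+\<omega>. H (s, \<omega>) \<partial>M) \<partial>lborel)"
proof -
  let ?I = "indicator {\<omega>\<in>space M. \<tau> \<omega> \<le> ennreal T} :: 'a \<Rightarrow> ennreal"
  let ?K = "\<lambda>(x, \<omega>). indicator {..ennreal T} x * H (enn2real x, \<omega>)"
  have HM [measurable]: "H \<in> borel_measurable (borel \<Otimes>\<^sub>M M)"
    by (rule measurable_subalgebra_pair[OF H])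
  have [measurable]: "(\<lambda>s. \<integral>\<^sup>+\<omega>. H (s, \<omega>) \<partial>M) \<in> borel_measurable borel" by measurable
  have "(\<integral>\<^sup>+\<omega>. ?I \<omega> * H (enn2real (\<tau> \<omega>), \<omega>) \<partial>M) = (\<integral>\<^sup>+\<omega>. ?K (\<tau> \<omega>, \<omega>) \<partial>M)"
    by (intro nn_integral_cong) (auto split: split_indicator)
  also have "\<dots> = (\<integral>\<^sup>+\<omega>'. (\<integral>\<^sup>+\<omega>. ?K (\<tau> \<omega>', \<omega>) \<partial>M) \<partial>M)"
    by (rule nn_integral_indep_subalgebra[OF \<tau> N indep]) measurable
  also have "\<dots> = (\<integral>\<^sup>+\<omega>'. ?I \<omega>' * (\<integral>\<^sup>+\<omega>. H (enn2real (\<tau> \<omega>'), \<omega>) \<partial>M) \<partial>M)"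
    by (intro nn_integral_cong) (auto split: split_indicator)
  also have "\<dots> = (\<integral>\<^sup>+\<omega>'. (\<integral>\<^sup>+\<omega>. H (enn2real (\<tau> \<omega>'), \<omega>) \<partial>M) \<partial>density M ?I)"
    by (subst nn_integral_density) auto
  also have "\<dots> = (\<integral>\<^sup>+s. (\<integral>\<^sup>+\<omega>. H (s, \<omega>) \<partial>M) \<partial>distr (density M ?I) borel (\<lambda>\<omega>. enn2real (\<tau> \<omega>)))"
    by (subst nn_integral_distr) auto
  also have "distr (density M ?I) borel (\<lambda>\<omega>. enn2real (\<tau> \<omega>)) = density lborel law_density"
    using interaction_time_law[OF \<tau> t set_integrable_lam lam_pos surv]
    unfolding law_density_def[abs_def] cum_intensity_def .
  also have "(\<integral>\<^sup>+s. (\<integral>\<^sup>+\<omega>. H (s, \<omega>) \<partial>M) \<partial>density lborel law_density)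
      = (\<integral>\<^sup>+s. law_density s * (\<integral>\<^sup>+\<omega>. H (s, \<omega>) \<partial>M) \<partial>lborel)"
    by (subst nn_integral_density) auto
  finally show ?thesis .
qed

text \<open>The law up to \<open>T\<close> has a Lebesgue density, so the single point
  \<open>T\<close> has mass zero. This reconciles \<open>\<tau> \<le> T\<close>, for which the law
  is known, with the strict inequality in the theorem.\<close>

lemma interaction_time_no_atom: "AE \<omega> in M. \<tau> \<omega> \<noteq> ennreal T"
proof -
  have "(\<integral>\<^sup>+\<omega>. indicator {\<omega>\<in>space M. \<tau> \<omega> \<le> ennreal T} \<omega> * indicator {T} (enn2real (\<tau> \<omega>)) \<partial>M)
    = (\<integral>\<^sup>+s. law_density s * (\<integral>\<^sup>+\<omega>. indicator {T} s \<partial>M) \<partial>lborel)"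
    using nn_integral_interaction_time[of "\<lambda>(s, \<omega>). indicator {T} s"] by simp
  also have "\<dots> = (\<integral>\<^sup>+s. 0 \<partial>(lborel :: real measure))"
  proof (rule nn_integral_cong_AE)
    show "AE s in lborel. law_density s * (\<integral>\<^sup>+\<omega>. indicator {T} s \<partial>M) = 0"
      using AE_lborel_singleton[of T] by eventually_elim simp
  qed
  finally have "(\<integral>\<^sup>+\<omega>. indicator {\<omega>\<in>space M. \<tau> \<omega> \<le> ennreal T} \<omega> * indicator {T} (enn2real (\<tau> \<omega>)) \<partial>M) = 0"
    by simp
  then have "AE \<omega> in M. indicator {\<omega>\<in>space M. \<tau> \<omega> \<le> ennreal T} \<omega> * indicator {T} (enn2real (\<tau> \<omega>)) = (0 :: ennreal)"
    by (subst (asm) nn_integral_0_iff_AE) auto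
  then show ?thesis using AE_space by eventually_elim (use t in \<open>auto split: split_indicator_asm\<close>)
qed

text \<open>The randomised term is kept general in \<open>G\<close> so that it can also be formed
  for \<bar>G\<bar>, -G and the product of \<open>G\<close> with the indicator of an event.\<close>

definition weighted :: "(real \<Rightarrow> 'a \<Rightarrow> real) \<Rightarrow> 'a \<Rightarrow> real" where
  "weighted G \<omega> = of_bool (\<tau> \<omega> < ennreal T) * (weight (enn2real (\<tau> \<omega>)) * G (enn2real (\<tau> \<omega>)) \<omega>)"

text \<open>Lebesgue measure on \<open>{t..T}\<close> as a finite measure in its own right, so that
  Fubini's theorem on its product with \<open>M\<close> applies directly.\<close>

definition time_measure :: "real measure" where
  "time_measure = restrict_space lborel {t..T}"

lemma sets_time_measure [measurable_cong]: "sets time_measure = sets (restrict_space borel {t..T})"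
  by (simp add: time_measure_def sets_restrict_space)

lemma finite_time_measure: "finite_measure time_measure"
  by (rule finite_measureI) (simp add: time_measure_def space_restrict_space emeasure_restrict_space emeasure_lborel_Icc_eq)

lemma sigma_finite_time_measure: "sigma_finite_measure time_measure"
  using finite_time_measure by (simp add: finite_measure_def)

lemma pair_sigma_finite_time_measure: "pair_sigma_finite time_measure M"
  using sigma_finite_time_measure sigma_finite_measure_axioms by (simp add: pair_sigma_finite_def)

lemma borel_imp_time_measurable: "H \<in> measurable (borel \<Otimes>\<^sub>M M) K \<Longrightarrow> H \<in> measurable (time_measure \<Otimes>\<^sub>M M) K"
proof -
  assume H: "H \<in> measurable (borel \<Otimes>\<^sub>M M) K"
  have [measurable]: "(\<lambda>x. x) \<in> measurable time_measure borel"
    unfolding time_measure_def by (rule measurable_restrict_space1) simp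
  have "(\<lambda>p. (fst p, snd p)) \<in> measurable (time_measure \<Otimes>\<^sub>M M) (borel \<Otimes>\<^sub>M M)" by measurable
  then show ?thesis using measurable_compose[OF _ H] by simp
qed

lemma weighted_measurable:
  assumes "(\<lambda>(s, \<omega>). G s \<omega>) \<in> borel_measurable (borel \<Otimes>\<^sub>M N)"
  shows "weighted G \<in> borel_measurable M"
proof -
  note [measurable] = measurable_subalgebra_pair[OF assms]
  show ?thesis unfolding weighted_def[abs_def] by measurable
qed

text \<open>Since \<open>ennreal\<close> sends negative numbers to 0, this is an identity between
  positive parts; the nonnegative \<open>weight\<close> leaves the sign to \<open>G\<close>.\<close>

lemma nn_integral_weighted:
  assumes G: "(\<lambda>(s, \<omega>). G s \<omega>) \<in> borel_measurable (borel \<Otimes>\<^sub>M N)"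
  shows "(\<integral>\<^sup>+\<omega>. ennreal (weighted G \<omega>) \<partial>M) = (\<integral>\<^sup>+(s, \<omega>). ennreal (G s \<omega>) \<partial>(time_measure \<Otimes>\<^sub>M M))"
proof -
  note [measurable] = measurable_subalgebra_pair[OF G] borel_imp_time_measurable[OF measurable_subalgebra_pair[OF G]] G
  have "(\<integral>\<^sup>+\<omega>. ennreal (weighted G \<omega>) \<partial>M)
      = (\<integral>\<^sup>+\<omega>. indicator {\<omega>\<in>space M. \<tau> \<omega> \<le> ennreal T} \<omega> *
          ennreal (weight (enn2real (\<tau> \<omega>)) * G (enn2real (\<tau> \<omega>)) \<omega>) \<partial>M)"
    by (intro nn_integral_cong_AE, use interaction_time_no_atom AE_space in eventually_elim)
       (auto simp: weighted_def less_le split: split_indicator)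
  also have "\<dots> = (\<integral>\<^sup>+s. law_density s * (\<integral>\<^sup>+\<omega>. ennreal (weight s * G s \<omega>) \<partial>M) \<partial>lborel)"
    using nn_integral_interaction_time[of "\<lambda>(s, \<omega>). ennreal (weight s * G s \<omega>)"] by simp
  also have "\<dots> = (\<integral>\<^sup>+s. (law_density s * ennreal (weight s)) * (\<integral>\<^sup>+\<omega>. ennreal (G s \<omega>) \<partial>M) \<partial>lborel)"
    by (intro nn_integral_cong) (simp add: ennreal_mult' weight_nonneg nn_integral_cmult mult.assoc)
  also have "\<dots> = (\<integral>\<^sup>+s. (\<integral>\<^sup>+\<omega>. ennreal (G s \<omega>) \<partial>M) * indicator {t..T} s \<partial>lborel)"
    unfolding law_density_weight
    by (intro nn_integral_cong_AE, use AE_lborel_singleton[of t] in eventually_elim)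
       (auto split: split_indicator)
  also have "\<dots> = (\<integral>\<^sup>+s. (\<integral>\<^sup>+\<omega>. ennreal (G s \<omega>) \<partial>M) \<partial>time_measure)"
    unfolding time_measure_def by (subst nn_integral_restrict_space) auto
  also have "\<dots> = (\<integral>\<^sup>+p. ennreal (case_prod G p) \<partial>(time_measure \<Otimes>\<^sub>M M))"
    by (subst nn_integral_fst[symmetric]) auto
  finally show ?thesis by (simp add: case_prod_unfold)
qed

text \<open>The preceding identity is applied to the absolute value of \<open>G\<close> for
  integrability, and to \<open>G\<close> and its negative for the two parts of the integral.\<close>

lemma integral_weighted:
  assumes G: "(\<lambda>(s, \<omega>). G s \<omega>) \<in> borel_measurable (borel \<Otimes>\<^sub>M N)"
    and int_G: "integrable (time_measure \<Otimes>\<^sub>M M) (\<lambda>(s, \<omega>). G s \<omega>)"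
  shows "integrable M (weighted G)"
    and "(\<integral>\<omega>. weighted G \<omega> \<partial>M) = (\<integral>(s, \<omega>). G s \<omega> \<partial>(time_measure \<Otimes>\<^sub>M M))"
proof -
  note [measurable] = G
  have abs: "weighted (\<lambda>s \<omega>. \<bar>G s \<omega>\<bar>) = (\<lambda>\<omega>. \<bar>weighted G \<omega>\<bar>)"
    by (auto simp: weighted_def abs_mult weight_nonneg fun_eq_iff)
  have minus: "weighted (\<lambda>s \<omega>. - G s \<omega>) = (\<lambda>\<omega>. - weighted G \<omega>)"
    by (auto simp: weighted_def fun_eq_iff)
  have "(\<integral>\<^sup>+\<omega>. ennreal \<bar>weighted G \<omega>\<bar> \<partial>M) = (\<integral>\<^sup>+(s, \<omega>). ennreal \<bar>G s \<omega>\<bar> \<partial>(time_measure \<Otimes>\<^sub>M M))"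
    using nn_integral_weighted[of "\<lambda>s \<omega>. \<bar>G s \<omega>\<bar>"] by (simp add: abs)
  also have "\<dots> < \<infinity>"
    using int_G by (simp add: integrable_iff_bounded case_prod_unfold)
  finally show *: "integrable M (weighted G)"
    using weighted_measurable[OF G] by (simp add: integrable_iff_bounded)
  have "(\<integral>\<^sup>+\<omega>. ennreal (- weighted G \<omega>) \<partial>M) = (\<integral>\<^sup>+(s, \<omega>). ennreal (- G s \<omega>) \<partial>(time_measure \<Otimes>\<^sub>M M))"
    using nn_integral_weighted[of "\<lambda>s \<omega>. - G s \<omega>"] by (simp add: minus)
  then show "(\<integral>\<omega>. weighted G \<omega> \<partial>M) = (\<integral>(s, \<omega>). G s \<omega> \<partial>(time_measure \<Otimes>\<^sub>M M))"
    unfolding real_lebesgue_integral_def[OF *] real_lebesgue_integral_def[OF int_G]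
    using nn_integral_weighted[OF G] by (simp add: case_prod_unfold)
qed

lemma real_cond_exp_weighted:
  assumes F: "subalgebra N F"
    and G: "(\<lambda>(s, \<omega>). G s \<omega>) \<in> borel_measurable (borel \<Otimes>\<^sub>M N)"
    and fin: "(\<integral>\<^sup>+u\<in>{t..T}. (\<integral>\<^sup>+\<omega>. ennreal \<bar>G u \<omega>\<bar> \<partial>M) \<partial>lborel) < \<infinity>"
    and Y: "cond_exp_version M F {t..T} G Y"
  shows "AE \<omega> in M. real_cond_exp M F (weighted G) \<omega> = (LINT u:{t..T}|lborel. Y u \<omega>)"
proof -
  have MF: "subalgebra M F" using F N by (auto simp: subalgebra_def)
  interpret finite_measure_subalgebra M F by unfold_locales (rule MF)
  interpret R: finite_measure time_measure by (rule finite_time_measure)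
  interpret RM: pair_sigma_finite time_measure M by (rule pair_sigma_finite_time_measure)
  have [measurable]: "(\<lambda>(s, \<omega>). G s \<omega>) \<in> borel_measurable (time_measure \<Otimes>\<^sub>M M)"
    by (intro borel_imp_time_measurable measurable_subalgebra_pair G)
  have Gu [measurable]: "G u \<in> borel_measurable M" for u
    using measurable_compose[OF measurable_Pair1' measurable_subalgebra_pair[OF G], of u] by simp
  have YF [measurable]: "(\<lambda>(u, \<omega>). Y u \<omega>) \<in> borel_measurable (time_measure \<Otimes>\<^sub>M F)"
    using Y unfolding cond_exp_version_def by (simp cong: measurable_cong_sets add: sets_time_measure)
  have [measurable]: "(\<lambda>(u, \<omega>). Y u \<omega>) \<in> borel_measurable (time_measure \<Otimes>\<^sub>M M)"
  proof -
    have [measurable]: "(\<lambda>\<omega>. \<omega>) \<in> measurable M F"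
      using MF by (auto simp: subalgebra_def measurable_def)
    have "(\<lambda>p. (fst p, snd p)) \<in> measurable (time_measure \<Otimes>\<^sub>M M) (time_measure \<Otimes>\<^sub>M F)" by measurable
    then show ?thesis using measurable_compose[OF _ YF] by simp
  qed
  have Yu: "AE u in time_measure. AE \<omega> in M. Y u \<omega> = real_cond_exp M F (G u) \<omega>"
    using Y unfolding cond_exp_version_def time_measure_def by (subst AE_restrict_space_iff) auto
  have fin_R: "(\<integral>\<^sup>+u. (\<integral>\<^sup>+\<omega>. ennreal \<bar>G u \<omega>\<bar> \<partial>M) \<partial>time_measure) < \<infinity>"
    using fin unfolding time_measure_def by (subst nn_integral_restrict_space) auto
  have int_G: "integrable (time_measure \<Otimes>\<^sub>M M) (\<lambda>(u, \<omega>). G u \<omega>)"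
    using fin_R by (simp add: integrable_iff_bounded case_prod_unfold flip: nn_integral_fst)
  \<comment> \<open>Conditional expectation is a contraction in L1; this transfers the integrability
    of \<open>G\<close> on the product space to \<open>Y\<close>.\<close>
  have abs_Yu: "AE u in time_measure. (\<integral>\<^sup>+\<omega>. ennreal \<bar>Y u \<omega>\<bar> \<partial>M) \<le> (\<integral>\<^sup>+\<omega>. ennreal \<bar>G u \<omega>\<bar> \<partial>M)"
    using Yu
  proof eventually_elim
    case (elim u)
    have "(\<integral>\<^sup>+\<omega>. ennreal \<bar>Y u \<omega>\<bar> \<partial>M) \<le> (\<integral>\<^sup>+\<omega>. nn_cond_exp M F (\<lambda>\<omega>. ennreal \<bar>G u \<omega>\<bar>) \<omega> \<partial>M)"
      by (rule nn_integral_mono_AE, use elim real_cond_exp_abs[OF Gu] in eventually_elim) simp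
    also have "\<dots> = (\<integral>\<^sup>+\<omega>. ennreal \<bar>G u \<omega>\<bar> \<partial>M)"
      using nn_cond_exp_intg[of "\<lambda>_. 1" "\<lambda>\<omega>. ennreal \<bar>G u \<omega>\<bar>"] by simp
    finally show ?case .
  qed
  have "(\<integral>\<^sup>+u. (\<integral>\<^sup>+\<omega>. ennreal \<bar>Y u \<omega>\<bar> \<partial>M) \<partial>time_measure) < \<infinity>"
    using nn_integral_mono_AE[OF abs_Yu] fin_R by (rule le_less_trans)
  then have int_Y: "integrable (time_measure \<Otimes>\<^sub>M M) (\<lambda>(u, \<omega>). Y u \<omega>)"
    by (simp add: integrable_iff_bounded case_prod_unfold flip: nn_integral_fst)
  have V: "(LINT u:{t..T}|lborel. Y u \<omega>) = (\<integral>u. Y u \<omega> \<partial>time_measure)" for \<omega>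
    unfolding time_measure_def set_lebesgue_integral_def by (subst integral_restrict_space) auto
  show ?thesis unfolding V
  proof (rule real_cond_exp_charact)
    show "integrable M (weighted G)" by (rule integral_weighted[OF G int_G])
    show "integrable M (\<lambda>\<omega>. \<integral>u. Y u \<omega> \<partial>time_measure)" by (rule RM.integrable_snd[OF int_Y])
    \<comment> \<open>Here the version has to be jointly measurable with respect to \<open>F\<close>
      and not merely \<open>M\<close>: only then is its time integral
      \<open>F\<close>-measurable.\<close>
    show "(\<lambda>\<omega>. \<integral>u. Y u \<omega> \<partial>time_measure) \<in> borel_measurable F"
      using measurable_pair_swap[OF YF] by (intro R.borel_measurable_lebesgue_integral) simp
    fix A assume A: "A \<in> sets F"
    then have [measurable]: "A \<in> sets N" "A \<in> sets M"
      using F MF by (auto simp: subalgebra_def)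
    have int_AY: "integrable (time_measure \<Otimes>\<^sub>M M) (\<lambda>(u, \<omega>). indicator A \<omega> * Y u \<omega>)"
      by (rule Bochner_Integration.integrable_bound[OF int_Y]) (auto split: split_indicator)
    have int_AG: "integrable (time_measure \<Otimes>\<^sub>M M) (\<lambda>(u, \<omega>). indicator A \<omega> * G u \<omega>)"
      by (rule Bochner_Integration.integrable_bound[OF int_G]) (auto split: split_indicator)
    \<comment> \<open>The event \<open>A\<close> lies in \<open>F\<close>, hence in
      \<open>N\<close>, so its indicator can be absorbed into the integrand without losing
      independence from \<open>\<tau>\<close>.\<close>
    have "(\<integral>\<omega>\<in>A. weighted G \<omega> \<partial>M) = (\<integral>\<omega>. weighted (\<lambda>u \<omega>. indicator A \<omega> * G u \<omega>) \<omega> \<partial>M)"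
      by (simp add: set_lebesgue_integral_def weighted_def ac_simps)
    also have "\<dots> = (\<integral>(u, \<omega>). indicator A \<omega> * G u \<omega> \<partial>(time_measure \<Otimes>\<^sub>M M))"
    proof (rule integral_weighted(2)[OF _ int_AG])
      note [measurable] = G
      show "(\<lambda>(u, \<omega>). indicator A \<omega> * G u \<omega>) \<in> borel_measurable (borel \<Otimes>\<^sub>M N)"
        by measurable
    qed
    also have "\<dots> = (\<integral>u. (\<integral>\<omega>. indicator A \<omega> * G u \<omega> \<partial>M) \<partial>time_measure)"
      using RM.integral_fst[OF int_AG] by simp
    also have "\<dots> = (\<integral>u. (\<integral>\<omega>. indicator A \<omega> * Y u \<omega> \<partial>M) \<partial>time_measure)"
    proof (rule integral_cong_AE)
      \<comment> \<open>The averaging property of \<open>real_cond_exp\<close> is available only for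
        integrable \<open>G u\<close>, that is, for almost every \<open>u\<close>.\<close>
      have "AE u in time_measure. integrable M (G u)"
        using RM.AE_integrable_fst[OF int_G] by simp
      then show "AE u in time_measure. (\<integral>\<omega>. indicator A \<omega> * G u \<omega> \<partial>M) = (\<integral>\<omega>. indicator A \<omega> * Y u \<omega> \<partial>M)"
        using Yu AE_space
      proof eventually_elim
        case (elim u)
        then have [measurable]: "Y u \<in> borel_measurable M"
          using measurable_compose[OF measurable_Pair1' \<open>(\<lambda>(u, \<omega>). Y u \<omega>) \<in> borel_measurable (time_measure \<Otimes>\<^sub>M M)\<close>, of u] by simp
        have "(\<integral>\<omega>. indicator A \<omega> * G u \<omega> \<partial>M) = (\<integral>\<omega>. indicator A \<omega> * real_cond_exp M F (G u) \<omega> \<partial>M)"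
          using real_cond_exp_intA[OF elim(1) A] by (simp add: set_lebesgue_integral_def)
        also have "\<dots> = (\<integral>\<omega>. indicator A \<omega> * Y u \<omega> \<partial>M)"
          by (rule integral_cong_AE) (use elim(2) in \<open>auto\<close>)
        finally show ?case .
      qed
    qed measurable
    also have "\<dots> = (\<integral>\<omega>. (\<integral>u. indicator A \<omega> * Y u \<omega> \<partial>time_measure) \<partial>M)"
      by (rule RM.Fubini_integral[OF int_AY, symmetric])
    also have "\<dots> = (\<integral>\<omega>\<in>A. (\<integral>u. Y u \<omega> \<partial>time_measure) \<partial>M)"
      by (simp add: set_lebesgue_integral_def)
    finally show "(\<integral>\<omega>\<in>A. weighted G \<omega> \<partial>M) = (\<integral>\<omega>\<in>A. (\<integral>u. Y u \<omega> \<partial>time_measure) \<partial>M)" .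
  qed
qed

end

text \<open>The existence clause keeps the second clause, which speaks of all versions
  \<open>Y\<close>, from being vacuous.\<close>

theorem proposition1:
  fixes M :: "'a measure"
    and T t :: real
    and W :: "real \<Rightarrow> 'a \<Rightarrow> real^'r"
    and X :: "real \<Rightarrow> 'a \<Rightarrow> real^'d"
    and \<gamma>\<^sub>0 :: "real^'d \<Rightarrow> real^'d"
    and \<gamma> :: "real^'d \<Rightarrow> real^'r^'d"
    and f :: "real^'d \<Rightarrow> real \<Rightarrow> real^'r \<Rightarrow> real"
    and \<Psi> v\<^sub>0 :: "real^'d \<Rightarrow> real"
    and z\<^sub>0 :: "real^'d \<Rightarrow> real^'r"
    and lam :: "real \<Rightarrow> real"
    and \<tau> :: "'a \<Rightarrow> ennreal"
  defines "F \<equiv> aug_filtration M W"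
  defines "G \<equiv> (\<lambda>u \<omega>. f (X u \<omega>) (v\<^sub>0 (X u \<omega>)) (z\<^sub>0 (X u \<omega>)))"
  assumes "prob_space M"
    and "0 < T"
    and "0 \<le> t" and "t < T"
    and "brownian_motion M T W"
    and "forward_process M F T W \<gamma>\<^sub>0 \<gamma> X"
    and "(\<lambda>(x, v, z). f x v z) \<in> borel_measurable borel"
    and "v\<^sub>0 \<in> borel_measurable borel"
    and "z\<^sub>0 \<in> borel_measurable borel"
    and "zeroth_order_solution M F T W X \<Psi> v\<^sub>0 z\<^sub>0"
    and "(\<integral>\<^sup>+u\<in>{t..T}. (\<integral>\<^sup>+\<omega>. ennreal \<bar>G u \<omega>\<bar> \<partial>M) \<partial>lborel) < \<infinity>"
    and "\<forall>s\<in>{0..T}. 0 < lam s"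
    and "set_integrable lborel {0..T} lam"
    and "interaction_time M T W lam t \<tau>"
  shows "(\<exists>Y. cond_exp_version M (F t) {t..T} G Y) \<and>
    (\<forall>Y V1. cond_exp_version M (F t) {t..T} G Y \<longrightarrow>
       V1 = (\<lambda>\<omega>. LINT u:{t..T}|lborel. Y u \<omega>) \<longrightarrow>
       (AE \<omega> in M. V1 \<omega> =
          of_bool (\<tau> \<omega> > ennreal t) *
          real_cond_exp M (F t)
            (\<lambda>\<omega>'. of_bool (\<tau> \<omega>' < ennreal T) *
               f_hat lam f v\<^sub>0 z\<^sub>0 t (enn2real (\<tau> \<omega>')) (X (enn2real (\<tau> \<omega>')) \<omega>')) \<omega>))"
proof -
  interpret prob_space M by fact
  have W: "W u \<in> borel_measurable M" if "u \<in> {0..T}" for u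
    using assms(7) that by (auto simp: brownian_motion_def)
  have MF: "subalgebra M (F s)" if "s \<in> {0..T}" for s
    unfolding F_def by (rule subalgebra_aug_filtration) (use W that in auto)
  have FF: "subalgebra (F T) (F s)" if "s \<in> {0..T}" for s
    unfolding F_def subalgebra_def using sets_aug_filtration_mono[of s T M W] that by simp
  have \<tau> [measurable]: "\<tau> \<in> borel_measurable M"
    and indep_nat: "indep_set (sets (nat_filtration M W T)) (sets (vimage_algebra (space M) \<tau> borel))"
    and surv: "\<And>s. s \<in> {t..T} \<Longrightarrow>
      prob {\<omega>\<in>space M. \<tau> \<omega> > ennreal s} = exp (- (LINT u:{t..s}|lborel. lam u))"
    using assms(16) by (auto simp: interaction_time_def)
  have "sets (vimage_algebra (space M) \<tau> borel) \<subseteq> events"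
    using measurable_sets[OF \<tau>] by (auto simp: sets_vimage_algebra2)
  then have indep: "indep_set (sets (F T)) (sets (vimage_algebra (space M) \<tau> borel))"
    unfolding F_def using W indep_nat by (intro indep_set_aug_filtration) auto

  interpret independent_interaction_time M "F T" T t lam \<tau>
    by unfold_locales (use assms MF indep surv in auto)

  \<comment> \<open>Paths are controlled only on \<open>{0..T}\<close>; freezing \<open>X\<close>
    outside this interval gives paths that are continuous on the whole line and unchanged inside
    it.\<close>
  define X' where "X' u = X (max 0 (min T u))" for u
  define \<phi> where "\<phi> x = f x (v\<^sub>0 x) (z\<^sub>0 x)" for x
  define G' where "G' u \<omega> = \<phi> (X' u \<omega>)" for u \<omega>
  have X'_eq: "X' u = X u" if "u \<in> {0..T}" for u using that by (simp add: X'_def)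
  have G'_eq: "G' u = G u" if "u \<in> {0..T}" for u
    using that by (simp add: G'_def G_def X'_eq \<phi>_def fun_eq_iff)
  have X_meas: "X u \<in> borel_measurable (F T)" if "u \<in> {0..T}" for u
  proof (rule borel_measurable_vec_componentwise)
    fix i
    have "(\<lambda>\<omega>. X u \<omega> $ i) \<in> borel_measurable (F u)"
      using assms(8) that by (auto simp: forward_process_def ito_process_def adapted_def)
    then show "(\<lambda>\<omega>. X u \<omega> $ i) \<in> borel_measurable (F T)"
      by (rule measurable_from_subalg[OF FF[OF that]])
  qed
  have [measurable]: "(\<lambda>(u, \<omega>). X' u \<omega>) \<in> borel_measurable (borel \<Otimes>\<^sub>M F T)"
  proof (rule borel_measurable_continuous_process)
    show "X' u \<in> borel_measurable (F T)" for u
      unfolding X'_def by (rule X_meas) (use \<open>0 < T\<close> in auto)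
    fix \<omega> assume "\<omega> \<in> space (F T)"
    then have "continuous_on {0..T} (\<lambda>s. X s \<omega>)"
      using assms(8) by (simp add: forward_process_def F_def)
    then show "continuous_on UNIV (\<lambda>u. X' u \<omega>)"
      unfolding X'_def by (rule continuous_on_compose2) (use \<open>0 < T\<close> in \<open>auto intro!: continuous_intros\<close>)
  qed
  have [measurable]: "\<phi> \<in> borel_measurable borel"
  proof -
    note [measurable] = assms(10,11)
    have "(\<lambda>x. (x, v\<^sub>0 x, z\<^sub>0 x)) \<in> borel_measurable borel" by measurable
    from measurable_compose[OF this assms(9)] show ?thesis by (simp add: \<phi>_def[abs_def])
  qed
  have G'_meas: "(\<lambda>(u, \<omega>). G' u \<omega>) \<in> borel_measurable (borel \<Otimes>\<^sub>M F T)"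
    unfolding G'_def by measurable
  have version_eq: "cond_exp_version M (F t) {t..T} G' Y \<longleftrightarrow> cond_exp_version M (F t) {t..T} G Y" for Y
  proof -
    have "(AE u\<in>{t..T} in lborel. AE \<omega> in M. Y u \<omega> = real_cond_exp M (F t) (G' u) \<omega>) \<longleftrightarrow>
      (AE u\<in>{t..T} in lborel. AE \<omega> in M. Y u \<omega> = real_cond_exp M (F t) (G u) \<omega>)"
      by (rule AE_cong) (use t G'_eq in auto)
    then show ?thesis unfolding cond_exp_version_def by simp
  qed
  have weighted_eq: "weighted G' = (\<lambda>\<omega>'. of_bool (\<tau> \<omega>' < ennreal T) *
      f_hat lam f v\<^sub>0 z\<^sub>0 t (enn2real (\<tau> \<omega>')) (X (enn2real (\<tau> \<omega>')) \<omega>'))"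
  proof
    fix \<omega>
    show "weighted G' \<omega> = of_bool (\<tau> \<omega> < ennreal T) *
      f_hat lam f v\<^sub>0 z\<^sub>0 t (enn2real (\<tau> \<omega>)) (X (enn2real (\<tau> \<omega>)) \<omega>)"
    proof (cases "\<tau> \<omega> < ennreal T")
      case True
      \<comment> \<open>On \<open>\<tau> < T\<close> the time is finite and \<open>enn2real\<close>
        loses nothing, so the clamped process and \<open>weight\<close> can be replaced by the
        original terms.\<close>
      then have "enn2real (\<tau> \<omega>) \<in> {0..T}"
        using \<open>0 < T\<close> by (cases "\<tau> \<omega>") (auto simp: ennreal_less_iff)
      then show ?thesis by (simp add: weighted_def weight_eq G'_eq G_def f_hat_def)
    qed (simp add: weighted_def)
  qed

  interpret Ft: finite_measure_subalgebra M "F t"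
    by unfold_locales (use MF t in auto)
  have "\<exists>Y. cond_exp_version M (F t) {t..T} G' Y"
  proof -
    have "(\<lambda>(u, \<omega>). G' u \<omega>) \<in> borel_measurable (time_measure \<Otimes>\<^sub>M M)"
      by (intro borel_imp_time_measurable measurable_subalgebra_pair G'_meas)
    then obtain Y where "(\<lambda>(u, \<omega>). Y u \<omega>) \<in> borel_measurable (time_measure \<Otimes>\<^sub>M F t)"
      "\<And>u. u \<in> space time_measure \<Longrightarrow> AE \<omega> in M. Y u \<omega> = real_cond_exp M (F t) (G' u) \<omega>"
      by (rule Ft.real_cond_exp_jointly_measurable) blast
    then have "cond_exp_version M (F t) {t..T} G' Y"
      unfolding cond_exp_version_def
      by (auto simp: time_measure_def space_restrict_space cong: measurable_cong_sets sets_pair_measure_cong)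
    then show ?thesis by blast
  qed
  moreover have "AE \<omega> in M. (LINT u:{t..T}|lborel. Y u \<omega>) =
      of_bool (\<tau> \<omega> > ennreal t) * real_cond_exp M (F t) (weighted G') \<omega>"
    if Y: "cond_exp_version M (F t) {t..T} G' Y" for Y
  proof -
    have fin: "(\<integral>\<^sup>+u\<in>{t..T}. (\<integral>\<^sup>+\<omega>. ennreal \<bar>G' u \<omega>\<bar> \<partial>M) \<partial>lborel) < \<infinity>"
    proof -
      have "(\<integral>\<^sup>+u\<in>{t..T}. (\<integral>\<^sup>+\<omega>. ennreal \<bar>G' u \<omega>\<bar> \<partial>M) \<partial>lborel)
          = (\<integral>\<^sup>+u\<in>{t..T}. (\<integral>\<^sup>+\<omega>. ennreal \<bar>G u \<omega>\<bar> \<partial>M) \<partial>lborel)"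
        by (intro nn_integral_cong) (use t G'_eq in \<open>auto split: split_indicator\<close>)
      then show ?thesis using assms(13) by simp
    qed
    have "AE \<omega> in M. \<tau> \<omega> > ennreal t"
      using surv[of t] t by (intro interaction_time_alive \<tau>) auto
    moreover have "AE \<omega> in M. real_cond_exp M (F t) (weighted G') \<omega> = (LINT u:{t..T}|lborel. Y u \<omega>)"
      using real_cond_exp_weighted[OF FF G'_meas fin Y] t by simp
    ultimately show ?thesis by eventually_elim simp
  qed
  ultimately show ?thesis unfolding version_eq weighted_eq by blast
qed

end
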